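(* Let $\Omega$, $\Sigma$, $D_0$, $\mathbb{C}^{D_0}$ and the normalized vector field $\widetilde{\mathcal{U}}$ be as in the context, let $f,g\in H^{1/2}_{co}(\Sigma)$, and let $u_0,v_0\in H^1(\Omega)$ solve $\mathrm{div}(\mathbb{C}^{D_0}\nabla u_0)=0$, $\mathrm{div}(\mathbb{C}^{D_0}\nabla v_0)=0$ in $\Omega$ with $u_0=f$, $v_0=g$ on $\partial\Omega$. Then, in $\Omega\setminus D_0$ and in $D_0$ separately, $$(\mathrm{div}\,\widetilde{\mathcal{U}})\,\mathbb{C}^{D_0}\nabla u_0\cdot\nabla v_0-\mathbb{C}^{D_0}\nabla u_0\cdot(\nabla v_0\,D\widetilde{\mathcal{U}})-\mathbb{C}^{D_0}\nabla v_0\cdot(\nabla u_0\,D\widetilde{\mathcal{U}})=\mathrm{div}\,b,$$ where $$b=(\mathbb{C}^{D_0}\nabla u_0\cdot\nabla v_0)\,\widetilde{\mathcal{U}}-(\mathbb{C}^{D_0}\nabla u_0)(\nabla v_0\,\widetilde{\mathcal{U}})-(\mathbb{C}^{D_0}\nabla v_0)(\nabla u_0\,\widetilde{\mathcal{U}}).$$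
   Context: $r_0>0$ is given; $\Omega\subset\mathbb{R}^3$ is a bounded domain with Lipschitz boundary, $\Sigma\subset\partial\Omega$ is open, and $D_0,D_1$ are closed polyhedra contained in $\Omega$ at distance at least $r_0$ from $\partial\Omega$ (sets homeomorphic to a closed ball, with boundary a finite union of plane polygonal faces, and $\Omega\setminus D_j$ with Lipschitz boundary) having the same number $N$ of vertices $V_i^{D_0}$, $V_i^{D_1}$, correspondingly ordered. $\mathcal{U}\in W^{1,\infty}(\mathbb{R}^3,\mathbb{R}^3)$ is a vector field with $\mathcal{U}(V_i^{D_0})=V_i^{D_1}-V_i^{D_0}$ for all $i$ and $\mathrm{supp}\,\mathcal{U}\subset\{\mathrm{dist}(x,D_0)\le r_0/4\}$. $W=(V_1^{D_1}-V_1^{D_0},\dots,V_N^{D_1}-V_N^{D_0})$ is assumed nonzero and $\widetilde{\mathcal{U}}=\mathcal{U}/|W|$. $\mathbb{C}^{D_0}=\mathbb{C}^i\chi_{D_0}+\mathbb{C}^e\chi_{\Omega\setminus D_0}$, where $\mathbb{C}^sA=2\mu^s\widehat A+\lambda^s(\mathrm{tr}A)I_3$ with constant $\lambda^s,\mu^s$, $\mu^s>0$, $2\mu^s+3\lambda^s>0$, $0\le\frac{\lambda^s}{2(\lambda^s+\mu^s)}<\frac12$, $s\in\{i,e\}$; $\widehat A=\frac12(A+A^T)$. Notation: $(\nabla u)_{ij}=\partial u_i/\partial x_j$; $D\widetilde{\mathcal{U}}$ is the Jacobian matrix; juxtaposition is the matrix-matrix or matrix-vector product; $A\cdot B=\sum_{ij}A_{ij}B_{ij}$.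 $H^{1/2}_{co}(\Sigma)=\{\varphi\in H^{1/2}(\partial\Omega;\mathbb{R}^3):\mathrm{supp}\,\varphi\subset\Sigma\}$. The identity is meant almost everywhere in the (open) sets $\Omega\setminus D_0$ and $\mathrm{Int}(D_0)$. *)

theory Defs
  imports "HOL-Analysis.Analysis"
begin

section \<open>Weak derivatives\<close>

definition locally_integrable_on ::
    "(real^'n \<Rightarrow> 'b::euclidean_space) \<Rightarrow> (real^'n) set \<Rightarrow> bool" where
  "locally_integrable_on f S \<longleftrightarrow>
     (\<forall>K. compact K \<and> K \<subseteq> S \<longrightarrow> f absolutely_integrable_on K)"

definition partial_deriv :: "'n \<Rightarrow> (real^'n \<Rightarrow> real) \<Rightarrow> real^'n \<Rightarrow> real" where
  "partial_deriv j f x = frechet_derivative f (at x) (axis j 1)"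

primrec C_k :: "nat \<Rightarrow> (real^'n \<Rightarrow> real) \<Rightarrow> bool" where
  "C_k 0 f \<longleftrightarrow> continuous_on UNIV f"
| "C_k (Suc k) f \<longleftrightarrow> f differentiable_on UNIV \<and> (\<forall>j. C_k k (partial_deriv j f))"

definition smooth_fun :: "(real^'n \<Rightarrow> real) \<Rightarrow> bool" where
  "smooth_fun f \<longleftrightarrow> (\<forall>k. C_k k f)"

definition test_function :: "(real^'n) set \<Rightarrow> (real^'n \<Rightarrow> real) \<Rightarrow> bool" where
  "test_function S \<phi> \<longleftrightarrow> smooth_fun \<phi> \<and>
     compact (closure {x. \<phi> x \<noteq> 0}) \<and> closure {x. \<phi> x \<noteq> 0} \<subseteq> S"

definition has_weak_partial ::
    "(real^'n) set \<Rightarrow> 'n \<Rightarrow> (real^'n \<Rightarrow> real) \<Rightarrow> (real^'n \<Rightarrow> real) \<Rightarrow> bool" where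
  "has_weak_partial S j u g \<longleftrightarrow>
     locally_integrable_on u S \<and> locally_integrable_on g S \<and>
     (\<forall>\<phi>. test_function S \<phi> \<longrightarrow>
        (LINT x:S|lebesgue. u x * partial_deriv j \<phi> x) = - (LINT x:S|lebesgue. g x * \<phi> x))"

definition has_weak_jacobian ::
    "(real^'n) set \<Rightarrow> (real^'n \<Rightarrow> real^'m) \<Rightarrow> (real^'n \<Rightarrow> real^'n^'m) \<Rightarrow> bool" where
  "has_weak_jacobian S u G \<longleftrightarrow>
     (\<forall>i j. has_weak_partial S j (\<lambda>x. u x $ i) (\<lambda>x. G x $ i $ j))"

text \<open>The divergence of a locally integrable vector field is the distributional one;
  the predicate says that it is represented by the locally integrable function \<open>d\<close>.\<close>

definition has_weak_div ::
    "(real^'n) set \<Rightarrow> (real^'n \<Rightarrow> real^'n) \<Rightarrow> (real^'n \<Rightarrow> real) \<Rightarrow> bool" where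
  "has_weak_div S b d \<longleftrightarrow>
     locally_integrable_on b S \<and> locally_integrable_on d S \<and>
     (\<forall>\<phi>. test_function S \<phi> \<longrightarrow>
        (LINT x:S|lebesgue. b x \<bullet> (\<chi> j. partial_deriv j \<phi> x)) = - (LINT x:S|lebesgue. d x * \<phi> x))"

text \<open>For matrix fields the divergence is taken row by row.\<close>

definition has_weak_div_matrix ::
    "(real^'n) set \<Rightarrow> (real^'n \<Rightarrow> real^'n^'m) \<Rightarrow> (real^'n \<Rightarrow> real^'m) \<Rightarrow> bool" where
  "has_weak_div_matrix S A F \<longleftrightarrow> (\<forall>i. has_weak_div S (\<lambda>x. A x $ i) (\<lambda>x. F x $ i))"


section \<open>Function spaces\<close>

definition square_integrable :: "'a measure \<Rightarrow> ('a \<Rightarrow> 'b::euclidean_space) \<Rightarrow> bool" where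
  "square_integrable M f \<longleftrightarrow> f \<in> borel_measurable M \<and> integrable M (\<lambda>x. (norm (f x))\<^sup>2)"

text \<open>\<open>H1_with_gradient S u G\<close>: \<open>u\<close> is in \<open>H\<^sup>1(S)\<close> and \<open>G\<close> is (a representative of) its
  weak gradient \<open>(\<partial>u\<^sub>i/\<partial>x\<^sub>j)\<^sub>i\<^sub>j\<close>.\<close>

definition H1_with_gradient ::
    "(real^'n) set \<Rightarrow> (real^'n \<Rightarrow> real^'m) \<Rightarrow> (real^'n \<Rightarrow> real^'n^'m) \<Rightarrow> bool" where
  "H1_with_gradient S u G \<longleftrightarrow> has_weak_jacobian S u G \<and>
     square_integrable (lebesgue_on S) u \<and> square_integrable (lebesgue_on S) G"

text \<open>\<open>W\<^sup>1\<^sup>,\<^sup>\<infinity>\<close> vector fields on the whole space, with weak Jacobian \<open>G\<close>. The field is evaluated at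
  points, so it is the continuous representative of its class.\<close>

definition W1inf_with_jacobian ::
    "(real^'n \<Rightarrow> real^'m) \<Rightarrow> (real^'n \<Rightarrow> real^'n^'m) \<Rightarrow> bool" where
  "W1inf_with_jacobian u G \<longleftrightarrow> continuous_on UNIV u \<and> has_weak_jacobian UNIV u G \<and>
     (\<exists>M. AE x in lebesgue. norm (u x) \<le> M \<and> norm (G x) \<le> M)"

text \<open>Two-dimensional Hausdorff measure, normalised (factor \<open>\<pi>\<close> times squared half-diameter) so that
  it is the surface measure on Lipschitz surfaces, on the Caratheodory-measurable sets.\<close>

definition hausdorff2_outer :: "(real^3) set \<Rightarrow> ennreal" where
  "hausdorff2_outer A =
     (SUP \<delta>\<in>{0::real<..}.
        INF C\<in>{C :: nat \<Rightarrow> (real^3) set.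
                 A \<subseteq> (\<Union>i. C i) \<and> (\<forall>i. bounded (C i) \<and> diameter (C i) \<le> \<delta>)}.
          (\<Sum>i. ennreal (pi * (diameter (C i) / 2)\<^sup>2)))"

definition hausdorff2 :: "(real^3) measure" where
  "hausdorff2 = measure_of UNIV (lambda_system UNIV UNIV hausdorff2_outer) hausdorff2_outer"

abbreviation boundary_measure :: "(real^3) set \<Rightarrow> (real^3) measure" where
  "boundary_measure S \<equiv> restrict_space hausdorff2 (frontier S)"

text \<open>\<open>H\<^sup>1\<^sup>/\<^sup>2(\<partial>S)\<close> with the Gagliardo seminorm on the two-dimensional surface \<open>\<partial>S\<close>.\<close>

definition H_half :: "(real^3) set \<Rightarrow> (real^3 \<Rightarrow> real^3) set" where
  "H_half S = {f. square_integrable (boundary_measure S) f \<and>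
     (\<integral>\<^sup>+x. (\<integral>\<^sup>+y. ennreal ((norm (f x - f y))\<^sup>2 / norm (x - y) ^ 3) \<partial>boundary_measure S)
        \<partial>boundary_measure S) < \<infinity>}"

text \<open>Support of a class of functions on \<open>\<partial>S\<close>.\<close>

definition boundary_support :: "(real^3) set \<Rightarrow> (real^3 \<Rightarrow> real^3) \<Rightarrow> (real^3) set" where
  "boundary_support S f = {x \<in> frontier S.
     \<forall>U. open U \<and> x \<in> U \<longrightarrow> \<not> (AE y in boundary_measure S. y \<in> U \<longrightarrow> f y = 0)}"

definition H_half_co :: "(real^3) set \<Rightarrow> (real^3) set \<Rightarrow> (real^3 \<Rightarrow> real^3) set" where
  "H_half_co S \<Gamma> = {f \<in> H_half S. boundary_support S f \<subseteq> \<Gamma>}"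

text \<open>\<open>u = f\<close> on \<open>\<partial>S\<close> in the sense of traces: \<open>u\<close> is an \<open>H\<^sup>1\<close> limit of maps smooth up to the
  boundary whose boundary values converge to \<open>f\<close> in \<open>L\<^sup>2(\<partial>S)\<close>.\<close>

definition has_trace ::
    "(real^3) set \<Rightarrow> (real^3 \<Rightarrow> real^3) \<Rightarrow> (real^3 \<Rightarrow> real^3^3) \<Rightarrow> (real^3 \<Rightarrow> real^3) \<Rightarrow> bool" where
  "has_trace S u G f \<longleftrightarrow> (\<exists>\<Phi> :: nat \<Rightarrow> real^3 \<Rightarrow> real^3.
     (\<forall>n i. smooth_fun (\<lambda>x. \<Phi> n x $ i)) \<and>
     (\<lambda>n. \<integral>\<^sup>+x. ennreal ((norm (\<Phi> n x - u x))\<^sup>2) \<partial>lebesgue_on S) \<longlonglongrightarrow> 0 \<and>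
     (\<lambda>n. \<integral>\<^sup>+x. ennreal ((norm (matrix (frechet_derivative (\<Phi> n) (at x)) - G x))\<^sup>2)
            \<partial>lebesgue_on S) \<longlonglongrightarrow> 0 \<and>
     (\<lambda>n. \<integral>\<^sup>+x. ennreal ((norm (\<Phi> n x - f x))\<^sup>2) \<partial>boundary_measure S) \<longlonglongrightarrow> 0)"


section \<open>Domains and polyhedra\<close>

text \<open>Near each boundary point the set is, in suitable orthonormal coordinates, the part of a
  cylinder lying above the graph of a Lipschitz function.\<close>

definition lipschitz_boundary :: "(real^3) set \<Rightarrow> bool" where
  "lipschitz_boundary S \<longleftrightarrow>
     (\<forall>p \<in> frontier S. \<exists>(T :: real^3 \<Rightarrow> real^3) (\<psi> :: real^2 \<Rightarrow> real) r h L.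
        orthogonal_transformation T \<and> r > 0 \<and> h > 0 \<and>
        L-lipschitz_on (ball 0 r) \<psi> \<and> \<psi> 0 = 0 \<and>
        (\<forall>y \<in> ball 0 r. \<forall>t. \<bar>t\<bar> < h \<longrightarrow>
           (p + T (vector [y $ 1, y $ 2, t]) \<in> S \<longleftrightarrow> t > \<psi> y)))"

text \<open>A polygon in the plane is the closed region bounded by a simple closed polygonal curve.\<close>

definition plane_polygon :: "(real^2) set \<Rightarrow> bool" where
  "plane_polygon P \<longleftrightarrow> (\<exists>g E. simple_path g \<and> pathfinish g = pathstart g \<and> finite E \<and>
     path_image g = (\<Union>(a, b)\<in>E. closed_segment a b) \<and>
     P = path_image g \<union> inside (path_image g))"

definition polygonal_face :: "(real^3) set \<Rightarrow> bool" where
  "polygonal_face F \<longleftrightarrow> (\<exists>P p (L :: real^2 \<Rightarrow> real^3).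
     plane_polygon P \<and> linear L \<and> inj L \<and> F = (\<lambda>y. p + L y) ` P)"

definition closed_polyhedron :: "(real^3) set \<Rightarrow> bool" where
  "closed_polyhedron D \<longleftrightarrow> D homeomorphic (cball 0 1 :: (real^3) set) \<and>
     (\<exists>\<F>. finite \<F> \<and> (\<forall>F\<in>\<F>. polygonal_face F) \<and> frontier D = \<Union>\<F>)"

text \<open>The polyhedron need not be convex, and the way its boundary is cut into polygons is not unique.
  Its vertices are therefore read off from its shape: they are the boundary points at
  which it is locally neither a half-space (interior points of a face) nor a wedge, convex or
  reentrant (interior points of an edge).\<close>

definition halfspace_at :: "real^3 \<Rightarrow> real^3 \<Rightarrow> (real^3) set" where
  "halfspace_at p a = {x. a \<bullet> (x - p) \<le> 0}"

definition face_point :: "(real^3) set \<Rightarrow> real^3 \<Rightarrow> bool" where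
  "face_point D p \<longleftrightarrow> (\<exists>\<epsilon>>0. \<exists>a. a \<noteq> 0 \<and> D \<inter> ball p \<epsilon> = halfspace_at p a \<inter> ball p \<epsilon>)"

definition edge_point :: "(real^3) set \<Rightarrow> real^3 \<Rightarrow> bool" where
  "edge_point D p \<longleftrightarrow> (\<exists>\<epsilon>>0. \<exists>a b. a \<noteq> b \<and> independent {a, b} \<and>
     (D \<inter> ball p \<epsilon> = halfspace_at p a \<inter> halfspace_at p b \<inter> ball p \<epsilon> \<or>
      D \<inter> ball p \<epsilon> = (halfspace_at p a \<union> halfspace_at p b) \<inter> ball p \<epsilon>))"

definition vertices :: "(real^3) set \<Rightarrow> (real^3) set" where
  "vertices D = {p \<in> frontier D. \<not> face_point D p \<and> \<not> edge_point D p}"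


section \<open>Elasticity tensor\<close>

definition sym_part :: "real^3^3 \<Rightarrow> real^3^3" where
  "sym_part A = (1/2) *\<^sub>R (A + transpose A)"

definition isotropic :: "real \<Rightarrow> real \<Rightarrow> real^3^3 \<Rightarrow> real^3^3" where
  "isotropic \<mu> l A = (2 * \<mu>) *\<^sub>R sym_part A + (l * trace A) *\<^sub>R mat 1"

definition lame_admissible :: "real \<Rightarrow> real \<Rightarrow> bool" where
  "lame_admissible \<mu> l \<longleftrightarrow> \<mu> > 0 \<and> 2 * \<mu> + 3 * l > 0 \<and>
     0 \<le> l / (2 * (l + \<mu>)) \<and> l / (2 * (l + \<mu>)) < 1/2"

definition elasticity ::
    "(real^3) set \<Rightarrow> (real^3) set \<Rightarrow> real \<Rightarrow> real \<Rightarrow> real \<Rightarrow> real \<Rightarrow> real^3 \<Rightarrow> real^3^3 \<Rightarrow> real^3^3" where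
  "elasticity \<Omega> D \<mu>i li \<mu>e le x A =
     indicator D x *\<^sub>R isotropic \<mu>i li A + indicator (\<Omega> - D) x *\<^sub>R isotropic \<mu>e le A"

text \<open>\<open>weak_solution \<Omega> C u G f\<close>: \<open>u \<in> H\<^sup>1(\<Omega>)\<close>, with weak gradient \<open>G\<close>, solves
  \<open>div (C \<nabla>u) = 0\<close> in \<open>\<Omega>\<close> with \<open>u = f\<close> on \<open>\<partial>\<Omega>\<close>.\<close>

definition weak_solution ::
    "(real^3) set \<Rightarrow> (real^3 \<Rightarrow> real^3^3 \<Rightarrow> real^3^3) \<Rightarrow> (real^3 \<Rightarrow> real^3) \<Rightarrow>
      (real^3 \<Rightarrow> real^3^3) \<Rightarrow> (real^3 \<Rightarrow> real^3) \<Rightarrow> bool" where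
  "weak_solution \<Omega> C u G f \<longleftrightarrow> H1_with_gradient \<Omega> u G \<and>
     has_weak_div_matrix \<Omega> (\<lambda>x. C x (G x)) (\<lambda>x. 0) \<and> has_trace \<Omega> u G f"

end

theory Submission
  imports Defs
begin

text \<open>On a region where the elasticity tensor is constant, \<open>b = T U\<close> with the Eshelby
  (energy-momentum) tensor \<open>T = (A \<bullet> \<nabla>v) I - A\<^sup>T \<nabla>v - B\<^sup>T \<nabla>u\<close>, where \<open>A\<close> and \<open>B\<close> are the
  stresses of \<open>u\<close> and \<open>v\<close>, and the left-hand side of the identity is \<open>T \<bullet> DU\<^sup>T\<close>. So the claim
  says that \<open>T\<close> is divergence free, tested against the merely Lipschitz field \<open>\<phi> U\<close>.

  Interior regularity of \<open>u\<close> and \<open>v\<close> is not needed. Convolving the gradients with a mollifier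
  preserves, near the support of \<open>\<phi>\<close>, both the equation and the vanishing of the curl; for the
  resulting smooth fields \<open>div T = 0\<close> is a pointwise computation, and the weak derivative of \<open>U\<close>
  may be tested with \<open>T\<close> times \<open>\<phi>\<close>. As \<open>T\<close> is quadratic in the gradients, convergence of the
  mollified gradients in \<open>L\<^sup>2\<close> of the support of \<open>\<phi>\<close> suffices to pass to the limit.\<close>

section \<open>Smooth functions and test functions\<close>

text \<open>The divergence in the claim is distributional, so the left-hand side can itself serve as
  \<open>div_b\<close>, and what remains is an integral identity against test functions in an open
  set where the law is constant. It contains products of two gradients that are merely in
  \<open>L2\<close>, and such products are not admissible test functions for either equation; this
  is the obstacle that smoothing removes. The gradients are extended by zero before smoothing, so
  convolutions live on the whole space, and the smoothed fields are examined only at points whose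
  kernel ball stays in the region. There both properties are weak formulations tested with the
  kernel: the equation with the reflected kernel, the vanishing curl with a first partial of it. The
  kernels are built from the very test function under consideration. The convergence in
  \<open>L2\<close> needs continuous approximants of the gradients; the trace condition supplies
  them, since its smooth maps converge in \<open>H1\<close>.\<close>

lemma partial_deriv_eqI:
  "(f has_derivative f') (at x) \<Longrightarrow> partial_deriv j f x = f' (axis j 1)"
  unfolding partial_deriv_def using frechet_derivative_at by metis

lemma C_k_SucD: "C_k (Suc k) f \<Longrightarrow> C_k k f"
proof (induction k arbitrary: f)
  case 0
  then show ?case by (auto intro: differentiable_imp_continuous_on)
next
  case (Suc k)
  then have "f differentiable_on UNIV" "C_k (Suc k) (partial_deriv j f)" for j
    unfolding C_k.simps(2)[of "Suc k"] by blast+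
  with Suc.IH show ?case unfolding C_k.simps(2)[of k] by blast
qed

lemma C_k_const: "C_k k (\<lambda>x::real^'n::finite. c)"
proof (induction k arbitrary: c)
  case (Suc k)
  have "partial_deriv j (\<lambda>x. c) = (\<lambda>x. 0)" for j :: "'n::finite"
    by (rule ext, rule partial_deriv_eqI[THEN trans]) (auto intro!: derivative_eq_intros)
  with Suc show ?case by auto
qed auto

lemma differentiable_on_UNIV_has:
  "f differentiable_on UNIV \<Longrightarrow> (f has_derivative frechet_derivative f (at x)) (at x)"
  by (metis UNIV_I differentiable_on_def frechet_derivative_works)

lemma partial_deriv_add:
  assumes "f differentiable_on UNIV" "g differentiable_on UNIV"
  shows "partial_deriv j (\<lambda>x. f x + g x) = (\<lambda>x. partial_deriv j f x + partial_deriv j g x)"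
proof
  fix x
  show "partial_deriv j (\<lambda>x. f x + g x) x = partial_deriv j f x + partial_deriv j g x"
    by (rule partial_deriv_eqI[THEN trans])
       (rule derivative_eq_intros assms[THEN differentiable_on_UNIV_has] refl | simp add: partial_deriv_def)+
qed

lemma partial_deriv_mult:
  assumes "f differentiable_on UNIV" "g differentiable_on UNIV"
  shows "partial_deriv j (\<lambda>x. f x * g x) = (\<lambda>x. f x * partial_deriv j g x + partial_deriv j f x * g x)"
proof
  fix x
  show "partial_deriv j (\<lambda>x. f x * g x) x = f x * partial_deriv j g x + partial_deriv j f x * g x"
    by (rule partial_deriv_eqI[THEN trans])
       (rule derivative_eq_intros assms[THEN differentiable_on_UNIV_has] refl | simp add: partial_deriv_def)+
qed

lemma C_k_add: "C_k k f \<Longrightarrow> C_k k g \<Longrightarrow> C_k k (\<lambda>x. f x + g x)"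
  by (induction k arbitrary: f g)
     (auto intro!: continuous_intros differentiable_on_add simp: partial_deriv_add)

text \<open>A partial derivative of a product still contains the undifferentiated factors. These are
  known to be of class \<open>Suc k\<close>, while the induction hypothesis asks for class
  \<open>k\<close>; \<open>C_k_SucD\<close> closes the gap.\<close>

lemma C_k_mult: "C_k k f \<Longrightarrow> C_k k g \<Longrightarrow> C_k k (\<lambda>x. f x * g x)"
proof (induction k arbitrary: f g)
  case 0
  then show ?case by (auto intro!: continuous_intros)
next
  case (Suc k)
  have "C_k k f" "C_k k g" using Suc.prems C_k_SucD by blast+
  with Suc show ?case
    by (auto intro!: differentiable_on_mult C_k_add simp: partial_deriv_mult)
qed

text \<open>Serves two kinds of \<open>c\<close>: a positive one to dilate the support of a kernel,
  and \<open>-1\<close> to reflect the kernel in a convolution.\<close>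

lemma partial_deriv_affine:
  assumes "f differentiable_on UNIV"
  shows "partial_deriv j (\<lambda>x. f (a + c *\<^sub>R x)) = (\<lambda>x. c * partial_deriv j f (a + c *\<^sub>R x))"
proof
  fix x
  have "linear (frechet_derivative f (at y))" for y
    using differentiable_on_UNIV_has[OF assms] has_derivative_linear by blast
  then have lin: "frechet_derivative f (at y) (c *\<^sub>R v) = c * frechet_derivative f (at y) v" for y v
    by (simp add: linear_cmul)
  have "((\<lambda>x. a + c *\<^sub>R x) has_derivative (\<lambda>v. c *\<^sub>R v)) (at x)"
    by (auto intro!: derivative_eq_intros)
  from diff_chain_at[OF this differentiable_on_UNIV_has[OF assms]]
  show "partial_deriv j (\<lambda>x. f (a + c *\<^sub>R x)) x = c * partial_deriv j f (a + c *\<^sub>R x)"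
    by (subst partial_deriv_eqI) (auto simp: o_def partial_deriv_def lin)
qed

lemma C_k_affine: "C_k k f \<Longrightarrow> C_k k (\<lambda>x. f (a + c *\<^sub>R x))"
proof (induction k arbitrary: f)
  case 0
  then show ?case
    by (auto intro!: continuous_intros intro: continuous_on_compose2)
next
  case (Suc k)
  have "(\<lambda>x. f (a + c *\<^sub>R x)) differentiable_on UNIV"
  proof -
    have "(f \<circ> (\<lambda>x. a + c *\<^sub>R x)) differentiable (at x)" for x
      using Suc.prems by (intro differentiable_chain_at) (auto simp: differentiable_on_def)
    then show ?thesis by (simp add: differentiable_on_def o_def)
  qed
  with Suc show ?case
    by (auto intro!: C_k_mult C_k_const simp: partial_deriv_affine)
qed

lemma smooth_fun_differentiable: "smooth_fun f \<Longrightarrow> f differentiable_on UNIV"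
  unfolding smooth_fun_def by (metis C_k.simps(2))

lemma smooth_fun_continuous: "smooth_fun f \<Longrightarrow> continuous_on UNIV f"
  unfolding smooth_fun_def by (metis C_k.simps(1))

lemma smooth_fun_partial: "smooth_fun f \<Longrightarrow> smooth_fun (partial_deriv j f)"
  unfolding smooth_fun_def by (metis C_k.simps(2))

lemma smooth_fun_const: "smooth_fun (\<lambda>x. c)"
  by (simp add: smooth_fun_def C_k_const)

lemma smooth_fun_add: "smooth_fun f \<Longrightarrow> smooth_fun g \<Longrightarrow> smooth_fun (\<lambda>x. f x + g x)"
  by (simp add: smooth_fun_def C_k_add)

lemma smooth_fun_mult: "smooth_fun f \<Longrightarrow> smooth_fun g \<Longrightarrow> smooth_fun (\<lambda>x. f x * g x)"
  by (simp add: smooth_fun_def C_k_mult)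

lemma smooth_fun_affine: "smooth_fun f \<Longrightarrow> smooth_fun (\<lambda>x. f (a + c *\<^sub>R x))"
  by (simp add: smooth_fun_def C_k_affine)

lemma smooth_fun_diff:
  assumes "smooth_fun f" "smooth_fun g" shows "smooth_fun (\<lambda>x. f x - g x)"
  using smooth_fun_add[OF assms(1) smooth_fun_mult[OF smooth_fun_const[of "-1"] assms(2)]] by simp

lemma smooth_fun_sum: "(\<And>i. i \<in> I \<Longrightarrow> smooth_fun (f i)) \<Longrightarrow> smooth_fun (\<lambda>x. \<Sum>i\<in>I. f i x)"
  by (induction I rule: infinite_finite_induct) (auto intro: smooth_fun_const smooth_fun_add)

lemma partial_deriv_const: "partial_deriv j (\<lambda>x. c) x = 0"
  by (rule partial_deriv_eqI[THEN trans]) (auto intro!: derivative_eq_intros)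

lemma has_derivative_partials:
  assumes "f differentiable_on UNIV"
  shows "(f has_derivative (\<lambda>v. \<Sum>j\<in>UNIV. v $ j * partial_deriv j f x)) (at x)"
proof -
  have lin: "linear (frechet_derivative f (at x))"
    using differentiable_on_UNIV_has[OF assms] has_derivative_linear by blast
  have "frechet_derivative f (at x) v = (\<Sum>j\<in>UNIV. v $ j * partial_deriv j f x)" for v
  proof -
    have "frechet_derivative f (at x) v = frechet_derivative f (at x) (\<Sum>j\<in>UNIV. v $ j *\<^sub>R axis j 1)"
      by (metis basis_expansion scalar_mult_eq_scaleR)
    then show ?thesis
      by (simp add: linear_sum[OF lin] linear_cmul[OF lin] partial_deriv_def)
  qed
  then show ?thesis using differentiable_on_UNIV_has[OF assms, of x] by presburger
qed

section \<open>Test functions and their bounds\<close>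

lemma test_function_smooth: "test_function S \<phi> \<Longrightarrow> smooth_fun \<phi>"
  by (simp add: test_function_def)

lemma test_function_mono: "test_function S \<phi> \<Longrightarrow> S \<subseteq> T \<Longrightarrow> test_function T \<phi>"
  by (auto simp: test_function_def)

lemma test_functionI:
  assumes "smooth_fun \<phi>" "compact K" "K \<subseteq> S" "\<And>x. x \<notin> K \<Longrightarrow> \<phi> x = 0"
  shows "test_function S \<phi>"
proof -
  have "{x. \<phi> x \<noteq> 0} \<subseteq> K" using assms(4) by auto
  then have "closure {x. \<phi> x \<noteq> 0} \<subseteq> K"
    by (simp add: assms(2) closure_minimal compact_imp_closed)
  with assms show ?thesis
    unfolding test_function_def
    by (meson bounded_subset closed_closure compact_eq_bounded_closed order_trans)
qed

lemma test_function_mult: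
  assumes "smooth_fun h" "test_function S \<phi>"
  shows "test_function S (\<lambda>x. h x * \<phi> x)"
proof (rule test_functionI)
  show "smooth_fun (\<lambda>x. h x * \<phi> x)" 
    using assms by (simp add: smooth_fun_mult test_function_def)
  show "compact (closure {x. \<phi> x \<noteq> 0})" "closure {x. \<phi> x \<noteq> 0} \<subseteq> S"
    using assms by (simp_all add: test_function_def)
  show "h x * \<phi> x = 0" if "x \<notin> closure {x. \<phi> x \<noteq> 0}" for x
    using that closure_subset[of "{x. \<phi> x \<noteq> 0}"] by auto
qed

lemma partial_deriv_zero_outside_support:
  assumes "x \<notin> closure {x. f x \<noteq> 0}"
  shows "partial_deriv j f x = 0"
proof -
  have "(f has_derivative (\<lambda>_. 0)) (at x within UNIV)"
    by (rule has_derivative_transform_within_open[of "\<lambda>_. 0" _ _ UNIV "- closure {x. f x \<noteq> 0}"])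
       (use assms closure_subset[of "{x. f x \<noteq> 0}"] in auto)
  then show ?thesis by (simp add: partial_deriv_eqI)
qed

lemma test_function_partial:
  assumes "test_function S \<phi>" shows "test_function S (partial_deriv j \<phi>)"
  using assms partial_deriv_zero_outside_support[of _ \<phi> j]
  by (intro test_functionI[of _ "closure {x. \<phi> x \<noteq> 0}"]) (auto simp: test_function_def smooth_fun_partial)

lemma test_function_bounded:
  assumes "test_function S \<phi>" obtains B where "B \<ge> 0" "\<And>x. \<bar>\<phi> x\<bar> \<le> B"
proof -
  let ?K = "closure {x. \<phi> x \<noteq> 0}"
  have "compact (\<phi> ` ?K)"
    using assms by (intro compact_continuous_image)
      (auto simp: test_function_def intro: continuous_on_subset smooth_fun_continuous)
  then obtain B where B: "B > 0" "\<And>x. x \<in> ?K \<Longrightarrow> \<bar>\<phi> x\<bar> \<le> B"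
    using compact_imp_bounded bounded_pos by (metis image_eqI real_norm_def)
  have "\<bar>\<phi> x\<bar> \<le> B" for x
    using B closure_subset[of "{x. \<phi> x \<noteq> 0}"] by (cases "\<phi> x = 0") auto
  with B(1) show ?thesis by (intro that[of B]) auto
qed

text \<open>One constant serves the increments and the linear part alike, so a first order Taylor
  remainder is at most \<open>2 * L\<close> times the increment. This is the dominating bound when a
  convolution is differentiated.\<close>

lemma test_function_lipschitz:
  assumes "test_function S \<phi>" obtains L where "L \<ge> 0" "\<And>x y. \<bar>\<phi> x - \<phi> y\<bar> \<le> L * norm (x - y)"
    "\<And>x v. \<bar>\<Sum>j\<in>UNIV. v $ j * partial_deriv j \<phi> x\<bar> \<le> L * norm v"
proof -
  have "\<exists>B. B \<ge> 0 \<and> (\<forall>x. \<bar>partial_deriv j \<phi> x\<bar> \<le> B)" for j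
    using test_function_bounded[OF test_function_partial[OF assms]] by metis
  then obtain B where B: "\<And>j. B j \<ge> 0" "\<And>j x. \<bar>partial_deriv j \<phi> x\<bar> \<le> B j" by metis
  define L where "L = (\<Sum>j\<in>UNIV. B j)"
  have le: "\<bar>\<Sum>j\<in>UNIV. v $ j * partial_deriv j \<phi> x\<bar> \<le> L * norm v" for v x
  proof -
    have "\<bar>\<Sum>j\<in>UNIV. v $ j * partial_deriv j \<phi> x\<bar> \<le> (\<Sum>j\<in>UNIV. norm v * B j)"
      by (rule order_trans[OF sum_abs], rule sum_mono)
         (auto simp: abs_mult intro!: mult_mono B component_le_norm_cart)
    then show ?thesis by (simp add: L_def sum_distrib_left mult.commute)
  qed
  have "norm (\<phi> x - \<phi> y) \<le> L * norm (x - y)" for x y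
  proof (rule differentiable_bound[of UNIV])
    show "(\<phi> has_derivative (\<lambda>v. \<Sum>j\<in>UNIV. v $ j * partial_deriv j \<phi> x)) (at x within UNIV)" for x
      using has_derivative_partials[of \<phi>] assms by (simp add: smooth_fun_differentiable test_function_def)
    show "onorm (\<lambda>v. \<Sum>j\<in>UNIV. v $ j * partial_deriv j \<phi> x) \<le> L" for x
      by (rule onorm_le) (simp add: le)
  qed auto
  moreover have "L \<ge> 0" unfolding L_def by (intro sum_nonneg B)
  ultimately show ?thesis using that[of L] le by auto
qed

section \<open>Symmetry of second partial derivatives\<close>

lemma partial_deriv_along_axis:
  assumes "f differentiable_on UNIV"
  shows "((\<lambda>s. f (y + s *\<^sub>R axis i 1)) has_real_derivative partial_deriv i f (y + s *\<^sub>R axis i 1)) (at s)"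
proof -
  have "((\<lambda>s. y + s *\<^sub>R axis i 1) has_derivative (\<lambda>s. s *\<^sub>R axis i 1)) (at s)"
    by (auto intro!: derivative_eq_intros)
  from diff_chain_at[OF this has_derivative_partials[OF assms]]
  have "((\<lambda>s. f (y + s *\<^sub>R axis i 1)) has_derivative
      (\<lambda>s'. \<Sum>j\<in>UNIV. (s' *\<^sub>R axis i 1) $ j * partial_deriv j f (y + s *\<^sub>R axis i 1))) (at s)"
    by (simp add: o_def)
  moreover have "(\<Sum>j\<in>UNIV. (s' *\<^sub>R axis i 1) $ j * partial_deriv j f z) = partial_deriv i f z * s'" for s' z
    by (simp add: axis_def if_distrib if_distribR sum.delta' mult.commute cong: if_cong)
  ultimately show ?thesis by (simp add: has_field_derivative_def)
qed

text \<open>The mean value theorem is applied once in direction \<open>i\<close> and once in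
  direction \<open>j\<close>. The second difference is symmetric in \<open>i\<close> and
  \<open>j\<close> while the right-hand side fixes an order of differentiation, which is what
  Schwarz's theorem exploits.\<close>

lemma second_difference_mean_value:
  assumes "smooth_fun f" "t > 0"
  shows "\<exists>\<sigma> \<tau>. \<bar>\<sigma>\<bar> < t \<and> \<bar>\<tau>\<bar> < t \<and>
    f (x + t *\<^sub>R axis i 1 + t *\<^sub>R axis j 1) - f (x + t *\<^sub>R axis i 1) - f (x + t *\<^sub>R axis j 1) + f x
      = t * (t * partial_deriv j (partial_deriv i f) (x + \<sigma> *\<^sub>R axis i 1 + \<tau> *\<^sub>R axis j 1))"
proof -
  let ?g = "\<lambda>s. f ((x + t *\<^sub>R axis j 1) + s *\<^sub>R axis i 1) - f (x + s *\<^sub>R axis i 1)"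
  let ?f' = "partial_deriv i f"
  have d: "f differentiable_on UNIV" "?f' differentiable_on UNIV"
    using assms smooth_fun_differentiable smooth_fun_partial by blast+
  have "\<exists>\<sigma>. 0 < \<sigma> \<and> \<sigma> < t \<and> ?g t - ?g 0 = (t - 0) *
      (?f' ((x + t *\<^sub>R axis j 1) + \<sigma> *\<^sub>R axis i 1) - ?f' (x + \<sigma> *\<^sub>R axis i 1))"
    by (rule MVT2) (use assms d in \<open>auto intro!: derivative_eq_intros partial_deriv_along_axis\<close>)
  then obtain \<sigma> where \<sigma>: "0 < \<sigma>" "\<sigma> < t" "?g t - ?g 0 = t *
      (?f' ((x + t *\<^sub>R axis j 1) + \<sigma> *\<^sub>R axis i 1) - ?f' (x + \<sigma> *\<^sub>R axis i 1))" by auto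
  let ?h = "\<lambda>s. ?f' ((x + \<sigma> *\<^sub>R axis i 1) + s *\<^sub>R axis j 1)"
  have "\<exists>\<tau>. 0 < \<tau> \<and> \<tau> < t \<and> ?h t - ?h 0 = (t - 0) *
      partial_deriv j ?f' ((x + \<sigma> *\<^sub>R axis i 1) + \<tau> *\<^sub>R axis j 1)"
    by (rule MVT2) (use assms d in \<open>auto intro!: partial_deriv_along_axis\<close>)
  then obtain \<tau> where \<tau>: "0 < \<tau>" "\<tau> < t" "?h t - ?h 0 = t *
      partial_deriv j ?f' ((x + \<sigma> *\<^sub>R axis i 1) + \<tau> *\<^sub>R axis j 1)" by auto
  have "?g t - ?g 0 = t * (?h t - ?h 0)" using \<sigma> by (simp add: algebra_simps)
  with \<tau> \<sigma> show ?thesis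
    by (intro exI[of _ \<sigma>] exI[of _ \<tau>]) (simp add: algebra_simps)
qed

lemma partial_deriv_commute:
  assumes "smooth_fun f"
  shows "partial_deriv i (partial_deriv j f) x = partial_deriv j (partial_deriv i f) x"
proof (rule ccontr)
  let ?a = "partial_deriv i (partial_deriv j f)" and ?b = "partial_deriv j (partial_deriv i f)"
  assume ne: "?a x \<noteq> ?b x"
  \<comment> \<open>Half of the gap: the two mixed derivatives agree at some pair of points near
    \<open>x\<close>, and each stays within \<open>e\<close> of its value at \<open>x\<close>, so
    the gap would be smaller than \<open>2 * e\<close>.\<close>
  define e where "e = \<bar>?a x - ?b x\<bar> / 2"
  have "e > 0" using ne by (simp add: e_def)
  have c: "isCont ?a x" "isCont ?b x"
    using smooth_fun_continuous[OF smooth_fun_partial[OF smooth_fun_partial[OF assms]]]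
    by (simp_all add: continuous_on_eq_continuous_at)
  then obtain d1 d2 where d: "d1 > 0" "d2 > 0" "\<And>y. dist y x < d1 \<Longrightarrow> dist (?a y) (?a x) < e"
      "\<And>y. dist y x < d2 \<Longrightarrow> dist (?b y) (?b x) < e"
    using \<open>e > 0\<close> unfolding continuous_at_eps_delta by metis
  \<comment> \<open>Moving along two axes by less than \<open>t\<close> each displaces the point by
    less than \<open>2 * t\<close>, hence the half.\<close>
  define t where "t = min d1 d2 / 2"
  have t: "t > 0" "2 * t \<le> d1" "2 * t \<le> d2" using d by (auto simp: t_def)
  have close: "dist (x + \<sigma> *\<^sub>R axis k 1 + \<tau> *\<^sub>R axis l 1) x < 2 * t" if "\<bar>\<sigma>\<bar> < t" "\<bar>\<tau>\<bar> < t" for \<sigma> \<tau> k l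
  proof -
    have "norm (\<sigma> *\<^sub>R axis k 1 + \<tau> *\<^sub>R axis l 1 :: real^'a) \<le> \<bar>\<sigma>\<bar> + \<bar>\<tau>\<bar>"
      by (rule norm_triangle_le) simp
    then show ?thesis using that by (simp add: dist_norm add.assoc)
  qed
  obtain \<sigma> \<tau> where 1: "\<bar>\<sigma>\<bar> < t" "\<bar>\<tau>\<bar> < t"
    "f (x + t *\<^sub>R axis i 1 + t *\<^sub>R axis j 1) - f (x + t *\<^sub>R axis i 1) - f (x + t *\<^sub>R axis j 1) + f x
      = t * (t * ?b (x + \<sigma> *\<^sub>R axis i 1 + \<tau> *\<^sub>R axis j 1))"
    using second_difference_mean_value[OF assms t(1)] by meson
  obtain \<sigma>' \<tau>' where 2: "\<bar>\<sigma>'\<bar> < t" "\<bar>\<tau>'\<bar> < t"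
    "f (x + t *\<^sub>R axis j 1 + t *\<^sub>R axis i 1) - f (x + t *\<^sub>R axis j 1) - f (x + t *\<^sub>R axis i 1) + f x
      = t * (t * ?a (x + \<sigma>' *\<^sub>R axis j 1 + \<tau>' *\<^sub>R axis i 1))"
    using second_difference_mean_value[OF assms t(1)] by meson
  have "?a (x + \<sigma>' *\<^sub>R axis j 1 + \<tau>' *\<^sub>R axis i 1) = ?b (x + \<sigma> *\<^sub>R axis i 1 + \<tau> *\<^sub>R axis j 1)"
    using 1(3) 2(3) t(1) by (simp add: algebra_simps)
  moreover have "dist (?a (x + \<sigma>' *\<^sub>R axis j 1 + \<tau>' *\<^sub>R axis i 1)) (?a x) < e"
    using close[OF 2(1,2)] t by (intro d(3)) (meson less_le_trans)
  moreover have "dist (?b (x + \<sigma> *\<^sub>R axis i 1 + \<tau> *\<^sub>R axis j 1)) (?b x) < e"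
    using close[OF 1(1,2)] t by (intro d(4)) (meson less_le_trans)
  ultimately have "\<bar>?a x - ?b x\<bar> < 2 * e" unfolding dist_real_def by linarith
  then show False by (simp add: e_def)
qed

section \<open>Convolution and mollification\<close>

text \<open>Taken over the completed Lebesgue measure, because the weak gradients are only Lebesgue
  measurable. Values may be vectors, so a whole matrix field is smoothed at once.\<close>

definition convolution :: "(real^'n \<Rightarrow> real) \<Rightarrow> (real^'n \<Rightarrow> 'b) \<Rightarrow> real^'n \<Rightarrow> 'b::euclidean_space" where
  "convolution \<rho> F x = (LINT y|lebesgue. \<rho> (x - y) *\<^sub>R F y)"

lemma measurable_reflect:
  assumes "continuous_on UNIV \<rho>"
  shows "(\<lambda>y. \<rho> (x - y)) \<in> borel_measurable lebesgue"
proof -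
  have "continuous_on UNIV (\<lambda>y. \<rho> (x - y))"
    by (rule continuous_on_compose2[OF assms]) (auto intro!: continuous_intros)
  then have "(\<lambda>y. \<rho> (x - y)) \<in> borel_measurable lborel"
    by (simp add: borel_measurable_continuous_onI)
  then show ?thesis by (rule measurable_completion)
qed

lemma integrable_bounded_scaleR:
  fixes F :: "'a \<Rightarrow> 'b::euclidean_space"
  assumes "integrable M F" "h \<in> borel_measurable M" "AE x in M. \<bar>h x\<bar> \<le> B"
  shows "integrable M (\<lambda>x. h x *\<^sub>R F x)"
proof (rule Bochner_Integration.integrable_bound)
  show "integrable M (\<lambda>x. B *\<^sub>R F x)" using assms by simp
  show "(\<lambda>x. h x *\<^sub>R F x) \<in> borel_measurable M" using assms by simp
  show "AE x in M. norm (h x *\<^sub>R F x) \<le> norm (B *\<^sub>R F x)"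
    using assms(3) by eventually_elim (auto intro!: mult_right_mono)
qed

lemma convolution_integrable:
  fixes F :: "real^'n \<Rightarrow> 'b::euclidean_space"
  assumes "test_function UNIV \<rho>" "integrable lebesgue F"
  shows "integrable lebesgue (\<lambda>y. \<rho> (x - y) *\<^sub>R F y)"
proof -
  obtain B where "\<And>x. \<bar>\<rho> x\<bar> \<le> B" using test_function_bounded[OF assms(1)] by metis
  then have "AE y in lebesgue. \<bar>\<rho> (x - y)\<bar> \<le> B" by simp
  with measurable_reflect[OF smooth_fun_continuous[OF test_function_smooth[OF assms(1)]]]
  show ?thesis by (rule integrable_bounded_scaleR[OF assms(2)])
qed

lemma convolution_bounded_linear:
  assumes "bounded_linear L" "test_function UNIV \<rho>" "integrable lebesgue F"
  shows "L (convolution \<rho> F x) = convolution \<rho> (\<lambda>y. L (F y)) x"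
proof -
  have "L (convolution \<rho> F x) = (LINT y|lebesgue. L (\<rho> (x - y) *\<^sub>R F y))"
    unfolding convolution_def
    by (rule integral_bounded_linear[OF assms(1) convolution_integrable[OF assms(2,3)], symmetric])
  then show ?thesis
    by (simp add: convolution_def linear_cmul[OF bounded_linear.linear[OF assms(1)]])
qed

text \<open>Differentiation under the integral: the kernel is Lipschitz with bounded gradient, so
  the quotients of its Taylor remainder, weighted by \<open>w\<close>, are dominated by a multiple
  of \<open>\<bar>w y\<bar>\<close>.\<close>

lemma convolution_has_derivative:
  fixes w :: "real^'n \<Rightarrow> real"
  assumes "test_function UNIV \<rho>" "integrable lebesgue w"
  shows "(convolution \<rho> w has_derivative
     (\<lambda>v. \<Sum>j\<in>UNIV. v $ j * convolution (partial_deriv j \<rho>) w x)) (at x)"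
proof -
  let ?D = "\<lambda>v. \<Sum>j\<in>UNIV. v $ j * convolution (partial_deriv j \<rho>) w x"
  let ?d = "\<lambda>z v. \<Sum>j\<in>UNIV. v $ j * partial_deriv j \<rho> z"
  have tj: "test_function UNIV (partial_deriv j \<rho>)" for j
    using assms test_function_partial by blast
  have sm: "smooth_fun \<rho>" using assms test_function_smooth by blast
  have wm: "w \<in> borel_measurable lebesgue" using assms by simp
  obtain L where L: "L \<ge> 0" "\<And>x y. \<bar>\<rho> x - \<rho> y\<bar> \<le> L * norm (x - y)" "\<And>x v. \<bar>?d x v\<bar> \<le> L * norm v"
    using test_function_lipschitz[OF assms(1)] by metis
  have Dint: "?D v = (LINT y|lebesgue. ?d (x - y) v * w y)" for v
  proof -
    have "?D v = (\<Sum>j\<in>UNIV. (LINT y|lebesgue. v $ j * (partial_deriv j \<rho> (x - y) * w y)))"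
      using convolution_integrable[OF tj assms(2)] by (simp add: convolution_def)
    also have "\<dots> = (LINT y|lebesgue. (\<Sum>j\<in>UNIV. v $ j * (partial_deriv j \<rho> (x - y) * w y)))"
      using convolution_integrable[OF tj assms(2)]
      by (intro Bochner_Integration.integral_sum[symmetric] integrable_mult_right) simp
    finally show ?thesis by (simp add: sum_distrib_right mult.assoc)
  qed
  have dint: "integrable lebesgue (\<lambda>y. ?d (x - y) v * w y)" for v
  proof -
    have "integrable lebesgue (\<lambda>y. \<Sum>j\<in>UNIV. v $ j * (partial_deriv j \<rho> (x - y) * w y))"
      using convolution_integrable[OF tj assms(2)]
      by (intro Bochner_Integration.integrable_sum integrable_mult_right) simp
    then show ?thesis by (simp add: sum_distrib_right mult.assoc)
  qed
  \<comment> \<open>Differentiability is reduced to a limit along sequences of increments, the form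
    in which dominated convergence applies.\<close>
  have "((\<lambda>h. norm (convolution \<rho> w (x + h) - convolution \<rho> w x - ?D h) / norm h) \<longlongrightarrow> 0) (at 0)"
    unfolding tendsto_at_iff_sequentially o_def
  proof (intro allI impI)
    fix h :: "nat \<Rightarrow> real^'n"
    assume h: "\<forall>i. h i \<in> UNIV - {0}" "h \<longlonglongrightarrow> 0"
    let ?q = "\<lambda>n y. (\<rho> (x + h n - y) - \<rho> (x - y) - ?d (x - y) (h n)) * w y / norm (h n)"
    have "convolution \<rho> w (x + v) - convolution \<rho> w x - ?D v =
        (LINT y|lebesgue. (\<rho> (x + v - y) - \<rho> (x - y) - ?d (x - y) v) * w y)" for v
      using convolution_integrable[OF assms] dint[of v] unfolding Dint
      by (simp add: convolution_def left_diff_distrib)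
    then have eq: "norm (convolution \<rho> w (x + h n) - convolution \<rho> w x - ?D (h n)) / norm (h n)
        = norm (LINT y|lebesgue. ?q n y)" for n
      by simp
    have "(\<lambda>n. LINT y|lebesgue. ?q n y) \<longlonglongrightarrow> (LINT y|(lebesgue::(real^'n) measure). 0)"
    proof (rule integral_dominated_convergence[where w = "\<lambda>y. 2 * L * \<bar>w y\<bar>"])
      show "(\<lambda>y. 0) \<in> borel_measurable lebesgue" by simp
      show "integrable lebesgue (\<lambda>y. 2 * L * \<bar>w y\<bar>)" using assms by simp
      show "?q n \<in> borel_measurable lebesgue" for n
        using measurable_reflect[OF smooth_fun_continuous[OF sm]] wm
          measurable_reflect[OF smooth_fun_continuous[OF smooth_fun_partial[OF sm]]]
        by (intro borel_measurable_divide borel_measurable_times borel_measurable_diff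
            borel_measurable_sum borel_measurable_const)
      show "AE y in lebesgue. (\<lambda>n. ?q n y) \<longlonglongrightarrow> 0"
      proof (intro AE_I2)
        fix y
        have "(\<rho> has_derivative ?d (x - y)) (at (x - y))"
          using has_derivative_partials sm smooth_fun_differentiable by blast
        then have "((\<lambda>h. norm (\<rho> (x - y + h) - \<rho> (x - y) - ?d (x - y) h) / norm h) \<longlongrightarrow> 0) (at 0)"
          by (simp add: has_derivative_at)
        then have "((\<lambda>h. (\<rho> (x - y + h) - \<rho> (x - y) - ?d (x - y) h) / norm h) \<longlongrightarrow> 0) (at 0)"
          by (rule_tac tendsto_norm_zero_cancel) simp
        then have "(\<lambda>n. (\<rho> (x - y + h n) - \<rho> (x - y) - ?d (x - y) (h n)) / norm (h n)) \<longlonglongrightarrow> 0"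
          using h unfolding tendsto_at_iff_sequentially o_def by blast
        then have "(\<lambda>n. (\<rho> (x - y + h n) - \<rho> (x - y) - ?d (x - y) (h n)) / norm (h n) * w y) \<longlonglongrightarrow> 0 * w y"
          by (intro tendsto_mult tendsto_const)
        then show "(\<lambda>n. ?q n y) \<longlonglongrightarrow> 0"
          by (simp add: algebra_simps)
      qed
      show "AE y in lebesgue. norm (?q n y) \<le> 2 * L * \<bar>w y\<bar>" for n
      proof (intro AE_I2)
        fix y
        have "\<bar>\<rho> (x + h n - y) - \<rho> (x - y)\<bar> \<le> L * norm (h n)"
          using L(2)[of "x + h n - y" "x - y"] by simp
        then have "\<bar>\<rho> (x + h n - y) - \<rho> (x - y) - ?d (x - y) (h n)\<bar> \<le> 2 * L * norm (h n)"
          using L(3)[of "h n" "x - y"] by linarith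
        moreover have "norm (h n) > 0" using h by auto
        ultimately have "\<bar>\<rho> (x + h n - y) - \<rho> (x - y) - ?d (x - y) (h n)\<bar> / norm (h n) \<le> 2 * L"
          by (simp add: pos_divide_le_eq)
        then have "\<bar>\<rho> (x + h n - y) - \<rho> (x - y) - ?d (x - y) (h n)\<bar> / norm (h n) * \<bar>w y\<bar> \<le> 2 * L * \<bar>w y\<bar>"
          by (rule mult_right_mono) simp
        then show "norm (?q n y) \<le> 2 * L * \<bar>w y\<bar>"
          by (simp add: abs_mult)
      qed
    qed
    then show "(\<lambda>n. norm (convolution \<rho> w (x + h n) - convolution \<rho> w x - ?D (h n)) / norm (h n)) \<longlonglongrightarrow> 0"
      unfolding eq by (intro tendsto_norm_zero) simp
  qed
  moreover have "linear ?D"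
    by (auto intro!: linearI simp: algebra_simps sum.distrib sum_distrib_left)
  ultimately show ?thesis
    by (simp add: has_derivative_at linear_linear)
qed

lemma partial_deriv_convolution:
  fixes w :: "real^'n \<Rightarrow> real"
  assumes "test_function UNIV \<rho>" "integrable lebesgue w"
  shows "partial_deriv j (convolution \<rho> w) x = convolution (partial_deriv j \<rho>) w x"
proof -
  have "partial_deriv j (convolution \<rho> w) x = (\<Sum>i\<in>UNIV. axis j 1 $ i * convolution (partial_deriv i \<rho>) w x)"
    by (rule partial_deriv_eqI[OF convolution_has_derivative[OF assms]])
  also have "\<dots> = (\<Sum>i\<in>UNIV. if i = j then convolution (partial_deriv i \<rho>) w x else 0)"
    by (intro sum.cong) (auto simp: axis_def)
  finally show ?thesis by simp
qed

text \<open>Each partial derivative passes to the kernel and leaves it a test function; hence the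
  induction on \<open>k\<close> runs over all kernels at once.\<close>

lemma smooth_fun_convolution:
  fixes w :: "real^'n \<Rightarrow> real"
  assumes "test_function UNIV \<rho>" "integrable lebesgue w"
  shows "smooth_fun (convolution \<rho> w)"
proof -
  have diff: "convolution \<rho> w differentiable_on UNIV" if "test_function UNIV \<rho>" for \<rho>
    using convolution_has_derivative[OF that assms(2)]
    by (auto simp: differentiable_on_def differentiable_def)
  have "C_k k (convolution \<rho> w)" for k using assms(1)
  proof (induction k arbitrary: \<rho>)
    case 0
    then show ?case by (simp add: diff differentiable_imp_continuous_on)
  next
    case (Suc k)
    have "partial_deriv j (convolution \<rho> w) = convolution (partial_deriv j \<rho>) w" for j
      using partial_deriv_convolution Suc.prems assms(2) by blast
    with Suc show ?case by (simp add: diff test_function_partial)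
  qed
  then show ?thesis by (simp add: smooth_fun_def)
qed

text \<open>The mass is a nonnegative integral, the form used by Tonelli and by Cauchy-Schwarz in
  \<open>ennreal\<close>; integrability follows from it. The kernel vanishes already on the sphere
  of radius \<open>r\<close>, so only points with \<open>norm (x - y) < r\<close>
  contribute.\<close>

definition mollifier :: "real \<Rightarrow> (real^'n \<Rightarrow> real) \<Rightarrow> bool" where
  "mollifier r \<rho> \<longleftrightarrow> test_function UNIV \<rho> \<and> (\<forall>x. \<rho> x \<ge> 0) \<and> (\<forall>x. norm x \<ge> r \<longrightarrow> \<rho> x = 0) \<and>
     (\<integral>\<^sup>+x. ennreal (\<rho> x) \<partial>lborel) = 1"

lemma test_function_integrable:
  assumes "test_function S \<phi>" shows "integrable lborel \<phi>"
proof -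
  let ?K = "closure {x. \<phi> x \<noteq> 0}"
  have "integrable lborel (\<lambda>x. indicator ?K x *\<^sub>R \<phi> x)"
    using assms by (intro borel_integrable_compact)
      (auto simp: test_function_def intro: continuous_on_subset smooth_fun_continuous)
  moreover have "(\<lambda>x. indicator ?K x *\<^sub>R \<phi> x) = \<phi>"
    using closure_subset[of "{x. \<phi> x \<noteq> 0}"] by (auto simp: indicator_def fun_eq_iff)
  ultimately show ?thesis by metis
qed

text \<open>Any test function that does not vanish yields mollifiers: square it, rescale and normalise.\<close>

lemma mollifier_exists:
  fixes \<phi> :: "real^'n \<Rightarrow> real"
  assumes "test_function S \<phi>" "\<phi> x0 \<noteq> 0" "r > 0"
  shows "\<exists>\<rho> :: real^'n \<Rightarrow> real. mollifier r \<rho>"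
proof -
  let ?K = "closure {x. \<phi> x \<noteq> 0}"
  have "bounded ?K" using assms(1) by (auto simp: test_function_def intro: compact_imp_bounded)
  then obtain R where R: "R > 0" "\<And>x. x \<in> ?K \<Longrightarrow> norm x < R"
    by (metis bounded_pos_less)
  \<comment> \<open>Dilating the argument by \<open>c\<close> sends points of norm at least
    \<open>r\<close> to points of norm at least \<open>R\<close>, and the support of
    \<open>\<phi>\<close> lies strictly inside radius \<open>R\<close>.\<close>
  define c where "c = R / r"
  have c: "c > 0" using R assms by (simp add: c_def)
  define \<psi> where "\<psi> z = \<phi> (0 + c *\<^sub>R z) * \<phi> (0 + c *\<^sub>R z)" for z
  have sm: "smooth_fun \<psi>"
    unfolding \<psi>_def using assms by (intro smooth_fun_mult smooth_fun_affine test_function_smooth)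
  have zero: "\<psi> z = 0" if "norm z \<ge> r" for z
  proof -
    have "c * r \<le> c * norm z" using that c by simp
    then have "norm (c *\<^sub>R z) \<ge> R" using assms(3) c R(1) by (simp add: c_def)
    then have "c *\<^sub>R z \<notin> ?K" using R(2) by force
    then have "\<phi> (c *\<^sub>R z) = 0" using closure_subset[of "{x. \<phi> x \<noteq> 0}"] by auto
    then show ?thesis by (simp add: \<psi>_def)
  qed
  have test: "test_function UNIV \<psi>"
    by (rule test_functionI[OF sm, of "cball 0 r"]) (auto intro: zero)
  have int: "integrable lborel \<psi>" using test_function_integrable[OF test] .
  define I where "I = (LINT x|lborel. \<psi> x)"
  have nonneg: "\<psi> x \<ge> 0" for x by (simp add: \<psi>_def)
  \<comment> \<open>Otherwise the nonnegative continuous \<open>\<psi>\<close> would vanish almost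
    everywhere, although it is positive on an open set containing the rescaled
    \<open>x0\<close>.\<close>
  have "I \<noteq> 0"
  proof
    assume "I = 0"
    then have "AE x in lborel. \<psi> x = 0"
      using integral_nonneg_eq_0_iff_AE[OF int] nonneg by (simp add: I_def)
    then have "AE x in lebesgue. \<psi> x = 0" by (rule AE_completion)
    then have "negligible {x. \<psi> x \<noteq> 0}"
      by (simp add: eventually_ae_filter_negligible) (meson negligible_subset)
    moreover have "open {x. \<psi> x \<noteq> 0}"
      using smooth_fun_continuous[OF sm] by (intro open_Collect_neq) auto
    moreover have "x0 /\<^sub>R c \<in> {x. \<psi> x \<noteq> 0}" using assms(2) c by (simp add: \<psi>_def)
    ultimately show False using open_not_negligible by blast
  qed
  moreover have "I \<ge> 0" unfolding I_def by (simp add: nonneg)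
  ultimately have I: "I > 0" by simp
  let ?\<rho> = "\<lambda>x. inverse I * \<psi> x"
  have "(\<integral>\<^sup>+x. ennreal (?\<rho> x) \<partial>lborel) = ennreal (LINT x|lborel. ?\<rho> x)"
    using int I nonneg by (intro nn_integral_eq_integral) auto
  also have "\<dots> = 1" using I by (simp add: I_def[symmetric])
  finally have "mollifier r ?\<rho>"
    unfolding mollifier_def using test_function_mult[OF smooth_fun_const test, of "inverse I"] nonneg zero I
    by auto
  then show ?thesis by blast
qed

section \<open>Averaging estimates for mollifiers\<close>

lemma nn_integral_reflect:
  fixes h :: "'a::euclidean_space \<Rightarrow> ennreal"
  assumes [measurable]: "h \<in> borel_measurable borel"
  shows "(\<integral>\<^sup>+y. h (x - y) \<partial>lborel) = (\<integral>\<^sup>+y. h y \<partial>lborel)"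
proof -
  have "(\<integral>\<^sup>+y. h y \<partial>lborel) = (\<integral>\<^sup>+y. h y \<partial>density (distr lborel borel (\<lambda>y. x + (-1) *\<^sub>R y)) (\<lambda>_. \<bar>-1::real\<bar> ^ DIM('a)))"
    by (subst lborel_affine[of "-1" x]) auto
  also have "\<dots> = (\<integral>\<^sup>+y. h (x - y) \<partial>lborel)"
    by (simp add: density_1 nn_integral_distr)
  finally show ?thesis ..
qed

lemma nn_integral_translate:
  fixes h :: "'a::euclidean_space \<Rightarrow> ennreal"
  assumes [measurable]: "h \<in> borel_measurable borel"
  shows "(\<integral>\<^sup>+x. h (x - y) \<partial>lborel) = (\<integral>\<^sup>+x. h x \<partial>lborel)"
proof -
  have "(\<integral>\<^sup>+x. h x \<partial>lborel) = (\<integral>\<^sup>+x. h x \<partial>density (distr lborel borel (\<lambda>x. - y + 1 *\<^sub>R x)) (\<lambda>_. \<bar>1::real\<bar> ^ DIM('a)))"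
    by (subst lborel_affine[of 1 "- y"]) auto
  also have "\<dots> = (\<integral>\<^sup>+x. h (x - y) \<partial>lborel)"
    by (simp add: density_1 nn_integral_distr)
  finally show ?thesis ..
qed

text \<open>A countable Borel cover by sets of finite measure keeps its measures under completion.
  This permits Tonelli for the completed measure.\<close>

lemma sigma_finite_lebesgue: "sigma_finite_measure (lebesgue :: 'a::euclidean_space measure)"
proof
  obtain A :: "'a set set" where "countable A" "A \<subseteq> sets lborel" "\<Union>A = space lborel" "\<forall>a\<in>A. emeasure lborel a \<noteq> \<infinity>"
    using lborel.sigma_finite_countable by blast
  then show "\<exists>A::'a set set. countable A \<and> A \<subseteq> sets lebesgue \<and> \<Union>A = space lebesgue \<and> (\<forall>a\<in>A. emeasure lebesgue a \<noteq> \<infinity>)"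
    by (intro exI[of _ A]) (auto simp: subset_iff)
qed

lemma mollifierD:
  assumes "mollifier r \<rho>"
  shows "test_function UNIV \<rho>" "\<rho> x \<ge> 0" "norm x \<ge> r \<Longrightarrow> \<rho> x = 0"
    "continuous_on UNIV \<rho>" "\<rho> \<in> borel_measurable borel"
    "(\<integral>\<^sup>+y. ennreal (\<rho> (z - y)) \<partial>lebesgue) = 1" "(\<integral>\<^sup>+y. ennreal (\<rho> (y - z)) \<partial>lebesgue) = 1"
proof -
  show "test_function UNIV \<rho>" "\<rho> x \<ge> 0" "norm x \<ge> r \<Longrightarrow> \<rho> x = 0"
    using assms by (auto simp: mollifier_def)
  then show c: "continuous_on UNIV \<rho>" using smooth_fun_continuous test_function_smooth by blast
  then show m: "\<rho> \<in> borel_measurable borel" by (rule borel_measurable_continuous_onI)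
  show "(\<integral>\<^sup>+y. ennreal (\<rho> (z - y)) \<partial>lebesgue) = 1" "(\<integral>\<^sup>+y. ennreal (\<rho> (y - z)) \<partial>lebesgue) = 1"
    using assms m nn_integral_reflect[of "\<lambda>x. ennreal (\<rho> x)" z] nn_integral_translate[of "\<lambda>x. ennreal (\<rho> x)" z]
    by (simp_all add: mollifier_def nn_integral_completion)
qed

lemma mollifier_integrable_reflect:
  assumes "mollifier r \<rho>"
  shows "integrable lebesgue (\<lambda>y. \<rho> (z - y))" "(LINT y|lebesgue. \<rho> (z - y)) = 1"
proof -
  have m: "(\<lambda>y. \<rho> (z - y)) \<in> borel_measurable lebesgue"
    using assms by (intro measurable_reflect mollifierD)
  show i: "integrable lebesgue (\<lambda>y. \<rho> (z - y))"
    by (rule integrableI_nonneg) (use m mollifierD[OF assms] in auto)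
  show "(LINT y|lebesgue. \<rho> (z - y)) = 1"
    using nn_integral_eq_integral[OF i] mollifierD[OF assms]
    by (simp add: integral_eq_nn_integral[OF m])
qed

text \<open>Jensen for the square with the probability weight \<open>\<rho> (x - y)\<close>,
  obtained from Cauchy-Schwarz by splitting the weight into two square roots. Unit mass enters
  twice: to write \<open>F x\<close> as an average and to evaluate one of the two factors.\<close>

lemma mollifier_jensen:
  fixes F :: "real^'n \<Rightarrow> 'b::euclidean_space"
  assumes \<rho>: "mollifier r \<rho>" and F: "integrable lebesgue F"
  shows "ennreal ((norm (convolution \<rho> F x - F x))\<^sup>2)
    \<le> (\<integral>\<^sup>+y. ennreal (\<rho> (x - y)) * ennreal ((norm (F y - F x))\<^sup>2) \<partial>lebesgue)"
proof -
  have [measurable]: "(\<lambda>y. \<rho> (x - y)) \<in> borel_measurable lebesgue"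
    using \<rho> by (intro measurable_reflect mollifierD)
  have [measurable]: "F \<in> borel_measurable lebesgue" using F by simp
  let ?s = "\<lambda>y. ennreal (sqrt (\<rho> (x - y)))" and ?n = "\<lambda>y. ennreal (norm (F y - F x))"
  have i1: "integrable lebesgue (\<lambda>y. \<rho> (x - y) *\<^sub>R F y)"
    using \<rho> F by (intro convolution_integrable mollifierD)
  have i2: "integrable lebesgue (\<lambda>y. \<rho> (x - y) *\<^sub>R F x)"
    using mollifier_integrable_reflect[OF \<rho>] by simp
  have eq: "convolution \<rho> F x - F x = (LINT y|lebesgue. \<rho> (x - y) *\<^sub>R (F y - F x))"
    using i1 i2 mollifier_integrable_reflect[OF \<rho>, of x]
    by (simp add: convolution_def scaleR_diff_right)
  have "integrable lebesgue (\<lambda>y. \<rho> (x - y) *\<^sub>R (F y - F x))"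
    using i1 i2 by (simp add: scaleR_diff_right)
  then have "ennreal (norm (convolution \<rho> F x - F x)) \<le> (\<integral>\<^sup>+y. ennreal (norm (\<rho> (x - y) *\<^sub>R (F y - F x))) \<partial>lebesgue)"
    unfolding eq by (rule integral_norm_bound_ennreal)
  also have "\<dots> = (\<integral>\<^sup>+y. ?s y * (?s y * ?n y) \<partial>lebesgue)"
    using mollifierD(2)[OF \<rho>]
    by (intro nn_integral_cong) (simp flip: ennreal_mult' ennreal_mult mult.assoc)
  finally have "(ennreal (norm (convolution \<rho> F x - F x)))\<^sup>2 \<le> (\<integral>\<^sup>+y. ?s y * (?s y * ?n y) \<partial>lebesgue)\<^sup>2"
    by (rule power_mono) simp
  also have "\<dots> \<le> (\<integral>\<^sup>+y. (?s y)\<^sup>2 \<partial>lebesgue) * (\<integral>\<^sup>+y. (?s y * ?n y)\<^sup>2 \<partial>lebesgue)"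
    by (rule Cauchy_Schwarz_nn_integral) measurable
  also have "(\<integral>\<^sup>+y. (?s y)\<^sup>2 \<partial>lebesgue) = 1"
    using mollifierD(6)[OF \<rho>, of x] mollifierD(2)[OF \<rho>] by (simp add: ennreal_power)
  also have "(\<integral>\<^sup>+y. (?s y * ?n y)\<^sup>2 \<partial>lebesgue) = (\<integral>\<^sup>+y. ennreal (\<rho> (x - y)) * ennreal ((norm (F y - F x))\<^sup>2) \<partial>lebesgue)"
    using mollifierD(2)[OF \<rho>] by (simp add: power_mult_distrib ennreal_power)
  finally show ?thesis by (simp add: ennreal_power)
qed

text \<open>For fixed \<open>y\<close> the kernel has unit mass as a function of \<open>x\<close>
  too, so averaging preserves the total integral.\<close>

lemma mollifier_tonelli:
  fixes h :: "real^'n \<Rightarrow> ennreal"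
  assumes \<rho>: "mollifier r \<rho>" and h: "h \<in> borel_measurable lebesgue"
  shows "(\<lambda>x. \<integral>\<^sup>+y. ennreal (\<rho> (x - y)) * h y \<partial>lebesgue) \<in> borel_measurable lebesgue"
    "(\<integral>\<^sup>+x. \<integral>\<^sup>+y. ennreal (\<rho> (x - y)) * h y \<partial>lebesgue \<partial>lebesgue) = (\<integral>\<^sup>+y. h y \<partial>lebesgue)"
proof -
  interpret sigma_finite_measure "lebesgue :: (real^'n) measure" by (rule sigma_finite_lebesgue)
  interpret pair_sigma_finite "lebesgue :: (real^'n) measure" "lebesgue :: (real^'n) measure" ..
  have [measurable]: "\<rho> \<in> borel_measurable borel" using mollifierD(5)[OF \<rho>] .
  \<comment> \<open>The kernel is Borel measurable, so the coordinates are viewed as maps from the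
    completed measure into the Borel sets; then \<open>x - y\<close> is measurable on the
    product.\<close>
  have id[measurable]: "(\<lambda>x. x) \<in> borel_measurable lebesgue" for x :: "real^'n"
    by (intro measurable_completion) simp
  have [measurable]: "fst \<in> borel_measurable (lebesgue \<Otimes>\<^sub>M (lebesgue :: (real^'n) measure))"
    "snd \<in> borel_measurable (lebesgue \<Otimes>\<^sub>M (lebesgue :: (real^'n) measure))"
    using measurable_compose[OF measurable_fst id] measurable_compose[OF measurable_snd id] by simp_all
  have [measurable]: "(\<lambda>z. h (snd z)) \<in> borel_measurable (lebesgue \<Otimes>\<^sub>M (lebesgue :: (real^'n) measure))"
    using h by measurable
  have m: "(\<lambda>(x, y). ennreal (\<rho> (x - y)) * h y) \<in> borel_measurable (lebesgue \<Otimes>\<^sub>M (lebesgue :: (real^'n) measure))"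
    unfolding case_prod_unfold by measurable
  show "(\<lambda>x. \<integral>\<^sup>+y. ennreal (\<rho> (x - y)) * h y \<partial>lebesgue) \<in> borel_measurable lebesgue"
    using sigma_finite_measure.borel_measurable_nn_integral_fst[OF sigma_finite_lebesgue m] by simp
  have "(\<integral>\<^sup>+x. \<integral>\<^sup>+y. ennreal (\<rho> (x - y)) * h y \<partial>lebesgue \<partial>lebesgue)
      = (\<integral>\<^sup>+y. \<integral>\<^sup>+x. ennreal (\<rho> (x - y)) * h y \<partial>lebesgue \<partial>lebesgue)"
    using Fubini'[OF m] by simp
  also have "\<dots> = (\<integral>\<^sup>+y. h y \<partial>lebesgue)"
  proof (intro nn_integral_cong)
    fix y :: "real^'n"
    have "(\<lambda>x. ennreal (\<rho> (x - y))) \<in> borel_measurable lebesgue"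
      by (intro measurable_completion) simp
    then show "(\<integral>\<^sup>+x. ennreal (\<rho> (x - y)) * h y \<partial>lebesgue) = h y"
      by (subst nn_integral_multc) (simp_all add: mollifierD(7)[OF \<rho>])
  qed
  finally show "(\<integral>\<^sup>+x. \<integral>\<^sup>+y. ennreal (\<rho> (x - y)) * h y \<partial>lebesgue \<partial>lebesgue) = (\<integral>\<^sup>+y. h y \<partial>lebesgue)" .
qed

section \<open>Local L2 convergence of mollifications\<close>

lemma norm_diff_sq_le3:
  fixes a b c d :: "'a::real_inner"
  shows "(norm (a - d))\<^sup>2 \<le> 3 * ((norm (a - b))\<^sup>2 + (norm (b - c))\<^sup>2 + (norm (d - c))\<^sup>2)"
proof -
  have "norm (a - d) \<le> norm (a - b) + norm (b - c) + norm (d - c)"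
    using norm_triangle_le[of "a - b" "b - d"] norm_triangle_ineq4[of "b - c" "d - c"] by simp
  then have "(norm (a - d))\<^sup>2 \<le> (norm (a - b) + norm (b - c) + norm (d - c))\<^sup>2"
    by (rule power_mono) simp
  also have "\<dots> \<le> 3 * ((norm (a - b))\<^sup>2 + (norm (b - c))\<^sup>2 + (norm (d - c))\<^sup>2)"
  proof -
    \<comment> \<open>The sum of the three pairwise squares is exactly the defect of the inequality
      with factor 3.\<close>
    have "0 \<le> (x - y)\<^sup>2 + (y - z)\<^sup>2 + (x - z)\<^sup>2" for x y z :: real by simp
    then have "(x + y + z)\<^sup>2 \<le> 3 * (x\<^sup>2 + y\<^sup>2 + z\<^sup>2)" for x y z :: real
      by (simp add: power2_eq_square algebra_simps)
    then show ?thesis .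
  qed
  finally show ?thesis .
qed

text \<open>After Jensen, \<open>F y - F x\<close> is split through \<open>g y\<close> and
  \<open>g x\<close>. The part at \<open>y\<close> is spread by the kernel and bounded by Tonelli,
  the middle part is the oscillation of \<open>g\<close> at distance below \<open>r\<close>, and the
  part at \<open>x\<close> is integrated directly. Hence the approximation error occurs twice, and
  over \<open>\<Omega>\<close>, because \<open>y\<close> may leave \<open>K\<close>.\<close>

lemma mollification_L2_bound:
  fixes F g :: "real^'n \<Rightarrow> 'b::euclidean_space"
  assumes \<rho>: "mollifier r \<rho>" and F: "integrable lebesgue F" and g: "continuous_on UNIV g"
    and K: "K \<in> sets lebesgue" and \<Omega>: "\<Omega> \<in> sets lebesgue" "K \<subseteq> \<Omega>"
    and near: "\<And>x y. x \<in> K \<Longrightarrow> norm (x - y) < r \<Longrightarrow> y \<in> \<Omega> \<and> norm (g y - g x) \<le> \<omega>"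
    and "\<omega> \<ge> 0"
  shows "(\<integral>\<^sup>+x. ennreal ((norm (convolution \<rho> F x - F x))\<^sup>2) * indicator K x \<partial>lebesgue)
    \<le> 3 * ((\<integral>\<^sup>+x. ennreal ((norm (F x - g x))\<^sup>2) * indicator \<Omega> x \<partial>lebesgue)
        + ennreal (\<omega>\<^sup>2) * emeasure lebesgue K
        + (\<integral>\<^sup>+x. ennreal ((norm (F x - g x))\<^sup>2) * indicator \<Omega> x \<partial>lebesgue))"
proof -
  let ?h = "\<lambda>x. ennreal ((norm (F x - g x))\<^sup>2) * indicator \<Omega> x"
  have [measurable]: "g \<in> borel_measurable lebesgue"
    by (intro measurable_completion) (simp add: borel_measurable_continuous_onI[OF g])
  have [measurable]: "F \<in> borel_measurable lebesgue" "K \<in> sets lebesgue" "\<Omega> \<in> sets lebesgue"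
    using F K \<Omega> by simp_all
  have hm[measurable]: "?h \<in> borel_measurable lebesgue" by measurable
  have [measurable]: "(\<lambda>x. \<integral>\<^sup>+y. ennreal (\<rho> (x - y)) * ?h y \<partial>lebesgue) \<in> borel_measurable lebesgue"
    by (rule mollifier_tonelli[OF \<rho> hm])
  have pt: "ennreal ((norm (convolution \<rho> F x - F x))\<^sup>2) * indicator K x
      \<le> 3 * ((\<integral>\<^sup>+y. ennreal (\<rho> (x - y)) * ?h y \<partial>lebesgue) + ennreal (\<omega>\<^sup>2) * indicator K x + ?h x)" for x
  proof (cases "x \<in> K")
    case True
    have [measurable]: "(\<lambda>y. \<rho> (x - y)) \<in> borel_measurable lebesgue"
      using \<rho> by (intro measurable_reflect mollifierD)
    have x: "x \<in> \<Omega>" using True \<Omega> by auto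
    have "ennreal ((norm (convolution \<rho> F x - F x))\<^sup>2)
        \<le> (\<integral>\<^sup>+y. ennreal (\<rho> (x - y)) * ennreal ((norm (F y - F x))\<^sup>2) \<partial>lebesgue)"
      by (rule mollifier_jensen[OF \<rho> F])
    also have "\<dots> \<le> (\<integral>\<^sup>+y. 3 * (ennreal (\<rho> (x - y)) * ?h y + ennreal (\<rho> (x - y)) * (ennreal (\<omega>\<^sup>2) + ?h x)) \<partial>lebesgue)"
    proof (intro nn_integral_mono)
      fix y
      show "ennreal (\<rho> (x - y)) * ennreal ((norm (F y - F x))\<^sup>2)
         \<le> 3 * (ennreal (\<rho> (x - y)) * ?h y + ennreal (\<rho> (x - y)) * (ennreal (\<omega>\<^sup>2) + ?h x))"
      proof (cases "norm (x - y) < r")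
        case True
        then have y: "y \<in> \<Omega>" "norm (g y - g x) \<le> \<omega>" using near \<open>x \<in> K\<close> by auto
        have "(norm (F y - F x))\<^sup>2 \<le> 3 * ((norm (F y - g y))\<^sup>2 + (norm (g y - g x))\<^sup>2 + (norm (F x - g x))\<^sup>2)"
          by (rule norm_diff_sq_le3)
        also have "\<dots> \<le> 3 * ((norm (F y - g y))\<^sup>2 + \<omega>\<^sup>2 + (norm (F x - g x))\<^sup>2)"
          using y(2) by (simp add: power_mono)
        finally have "ennreal ((norm (F y - F x))\<^sup>2) \<le> ennreal (3 * ((norm (F y - g y))\<^sup>2 + \<omega>\<^sup>2 + (norm (F x - g x))\<^sup>2))"
          by (rule ennreal_leI)
        also have "\<dots> = 3 * (?h y + ennreal (\<omega>\<^sup>2) + ?h x)"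
          using x y by (simp add: ennreal_mult)
        finally have "ennreal (\<rho> (x - y)) * ennreal ((norm (F y - F x))\<^sup>2)
           \<le> ennreal (\<rho> (x - y)) * (3 * (?h y + ennreal (\<omega>\<^sup>2) + ?h x))"
          by (rule mult_left_mono) simp
        then show ?thesis by (simp add: algebra_simps)
      next
        case False
        then show ?thesis using mollifierD(3)[OF \<rho>] by simp
      qed
    qed
    also have "\<dots> = 3 * ((\<integral>\<^sup>+y. ennreal (\<rho> (x - y)) * ?h y \<partial>lebesgue) + (ennreal (\<omega>\<^sup>2) + ?h x))"
      by (subst nn_integral_cmult, measurable, subst nn_integral_add, measurable, subst nn_integral_multc, measurable)
         (simp add: mollifierD(6)[OF \<rho>])
    finally show ?thesis using True by (simp add: add.assoc)
  qed simp
  have "(\<integral>\<^sup>+x. ennreal ((norm (convolution \<rho> F x - F x))\<^sup>2) * indicator K x \<partial>lebesgue)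
     \<le> (\<integral>\<^sup>+x. 3 * ((\<integral>\<^sup>+y. ennreal (\<rho> (x - y)) * ?h y \<partial>lebesgue) + ennreal (\<omega>\<^sup>2) * indicator K x + ?h x) \<partial>lebesgue)"
    by (intro nn_integral_mono pt)
  also have "\<dots> = 3 * ((\<integral>\<^sup>+x. \<integral>\<^sup>+y. ennreal (\<rho> (x - y)) * ?h y \<partial>lebesgue \<partial>lebesgue)
        + ennreal (\<omega>\<^sup>2) * emeasure lebesgue K + (\<integral>\<^sup>+x. ?h x \<partial>lebesgue))"
    by (subst nn_integral_cmult, measurable, subst nn_integral_add, measurable, subst nn_integral_add, measurable,
        subst nn_integral_cmult_indicator, measurable)
  finally show ?thesis by (simp add: mollifier_tonelli(2)[OF \<rho> hm])
qed

text \<open>Uniform continuity with one point in \<open>K\<close> and the other one free: it is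
  taken on a ball of radius \<open>R + 1\<close>, where \<open>R\<close> bounds \<open>K\<close>,
  and the distance is capped by 1 so that the free point stays in that ball.\<close>

lemma continuous_near_compact:
  fixes g :: "'a::euclidean_space \<Rightarrow> 'b::metric_space"
  assumes "continuous_on UNIV g" "compact K" "\<omega> > 0"
  obtains d where "d > 0" "\<And>x y. x \<in> K \<Longrightarrow> norm (x - y) < d \<Longrightarrow> dist (g y) (g x) < \<omega>"
proof -
  obtain R where R: "\<And>x. x \<in> K \<Longrightarrow> norm x \<le> R"
    using compact_imp_bounded[OF assms(2)] unfolding bounded_iff by blast
  have "uniformly_continuous_on (cball 0 (R + 1)) g"
    by (rule compact_uniformly_continuous[OF continuous_on_subset[OF assms(1) subset_UNIV] compact_cball])
  then obtain d where d: "d > 0"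
    "\<And>x y. x \<in> cball 0 (R + 1) \<Longrightarrow> y \<in> cball 0 (R + 1) \<Longrightarrow> dist y x < d \<Longrightarrow> dist (g y) (g x) < \<omega>"
    using assms(3) unfolding uniformly_continuous_on_def by metis
  show ?thesis
  proof
    show "min d 1 > 0" using d by simp
    fix x y assume xy: "x \<in> K" "norm (x - y) < min d 1"
    have "norm y \<le> norm x + norm (x - y)"
      using norm_triangle_ineq[of x "y - x"] by (simp add: norm_minus_commute)
    then show "dist (g y) (g x) < \<omega>"
      using xy R[OF xy(1)] by (intro d(2)) (auto simp: dist_norm norm_minus_commute)
  qed
qed

lemma compact_near_open:
  fixes K S :: "'a::euclidean_space set"
  assumes "compact K" "open S" "K \<subseteq> S"
  obtains d where "d > 0" "\<And>x y. x \<in> K \<Longrightarrow> norm (x - y) < d \<Longrightarrow> y \<in> S"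
proof -
  obtain d where d: "d > 0" "(\<Union>x\<in>K. ball x d) \<subseteq> S"
    by (rule compact_subset_open_imp_ball_epsilon_subset[OF assms])
  have "y \<in> S" if "x \<in> K" "norm (x - y) < d" for x y
  proof -
    have "y \<in> (\<Union>x\<in>K. ball x d)" using that by (auto simp: dist_norm)
    with d(2) show ?thesis by (rule subsetD)
  qed
  with d(1) show ?thesis by (rule that)
qed

lemma tendsto_ennreal_0I:
  fixes f :: "'a \<Rightarrow> ennreal"
  assumes "\<And>e::real. e > 0 \<Longrightarrow> eventually (\<lambda>x. f x \<le> ennreal e) F"
  shows "(f \<longlongrightarrow> 0) F"
proof (rule order_tendstoI)
  fix a :: ennreal assume "0 < a"
  then obtain c where c: "0 < c" "c < a" using dense by blast
  have "c \<noteq> top" using c(2) by (metis not_top_less)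
  then obtain e where e: "c = ennreal e" "e \<ge> 0" by (metis ennreal_cases)
  with c(1) have "e > 0" by (metis ennreal_0 less_irrefl order_le_less)
  have "f x < a" if "f x \<le> ennreal e" for x
    using that c(2) unfolding e(1) by (rule le_less_trans)
  with assms[OF \<open>e > 0\<close>] show "eventually (\<lambda>x. f x < a) F"
    by (rule eventually_mono)
qed auto

text \<open>Convergence is local: kernels of small radius centred in the compact \<open>K\<close> do
  not leave \<open>\<Omega>\<close>, so an approximation of \<open>F\<close> on
  \<open>\<Omega>\<close> by continuous functions is enough, and their uniform continuity is used
  near \<open>K\<close>.\<close>

lemma mollification_L2_tendsto:
  fixes F :: "real^'n \<Rightarrow> 'b::euclidean_space"
  assumes \<rho>: "\<And>n. mollifier (r n) (\<rho> n)" and r: "r \<longlonglongrightarrow> 0"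
    and F: "integrable lebesgue F" and K: "compact K" "K \<subseteq> \<Omega>" and \<Omega>: "open \<Omega>"
    and approx: "\<And>e::real. e > 0 \<Longrightarrow> \<exists>g. continuous_on UNIV g \<and>
       (\<integral>\<^sup>+x. ennreal ((norm (F x - g x))\<^sup>2) * indicator \<Omega> x \<partial>lebesgue) \<le> ennreal e"
  shows "(\<lambda>n. \<integral>\<^sup>+x. ennreal ((norm (convolution (\<rho> n) F x - F x))\<^sup>2) * indicator K x \<partial>lebesgue) \<longlonglongrightarrow> 0"
proof (rule tendsto_ennreal_0I)
  fix e :: real assume "e > 0"
  define m where "m = measure lebesgue K"
  have m: "emeasure lebesgue K = ennreal m" "m \<ge> 0"
    using emeasure_eq_ennreal_measure[OF fmeasurableD2[OF lmeasurable_compact[OF K(1)]]]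
    by (simp_all add: m_def)
  obtain g where g: "continuous_on UNIV g"
    "(\<integral>\<^sup>+x. ennreal ((norm (F x - g x))\<^sup>2) * indicator \<Omega> x \<partial>lebesgue) \<le> ennreal (e / 12)"
    using approx[of "e / 12"] \<open>e > 0\<close> by auto
  \<comment> \<open>The estimate carries a factor 3 and two errors \<open>e / 12\<close>, which
    together cost \<open>e / 2\<close>; this \<open>\<omega>\<close> keeps the oscillation term
    within the other half. The summand 1 covers the case that \<open>K\<close> is a null
    set.\<close>
  define \<omega> where "\<omega> = sqrt (e / (6 * (m + 1)))"
  have \<omega>: "\<omega> > 0" "\<omega>\<^sup>2 = e / (6 * (m + 1))" using \<open>e > 0\<close> m by (simp_all add: \<omega>_def)
  obtain d1 where d1: "d1 > 0" "\<And>x y. x \<in> K \<Longrightarrow> norm (x - y) < d1 \<Longrightarrow> dist (g y) (g x) < \<omega>"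
    using continuous_near_compact[OF g(1) K(1) \<omega>(1)] by blast
  obtain d2 where d2: "d2 > 0" "\<And>x y. x \<in> K \<Longrightarrow> norm (x - y) < d2 \<Longrightarrow> y \<in> \<Omega>"
    using compact_near_open[OF K(1) \<Omega> K(2)] by blast
  have "eventually (\<lambda>n. r n < min d1 d2) sequentially"
    using order_tendstoD(2)[OF r, of "min d1 d2"] d1 d2 by simp
  then show "eventually (\<lambda>n. (\<integral>\<^sup>+x. ennreal ((norm (convolution (\<rho> n) F x - F x))\<^sup>2) * indicator K x \<partial>lebesgue) \<le> ennreal e) sequentially"
  proof eventually_elim
    case (elim n)
    have "(\<integral>\<^sup>+x. ennreal ((norm (convolution (\<rho> n) F x - F x))\<^sup>2) * indicator K x \<partial>lebesgue)
      \<le> 3 * ((\<integral>\<^sup>+x. ennreal ((norm (F x - g x))\<^sup>2) * indicator \<Omega> x \<partial>lebesgue)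
        + ennreal (\<omega>\<^sup>2) * emeasure lebesgue K
        + (\<integral>\<^sup>+x. ennreal ((norm (F x - g x))\<^sup>2) * indicator \<Omega> x \<partial>lebesgue))"
    proof (rule mollification_L2_bound[OF \<rho> F g(1)])
      show "K \<in> sets lebesgue" by (rule fmeasurableD[OF lmeasurable_compact[OF K(1)]])
      show "\<Omega> \<in> sets lebesgue" by (rule sets_completionI_sets) (simp add: \<Omega> borel_open)
      show "K \<subseteq> \<Omega>" "\<omega> \<ge> 0" using K \<omega> by auto
      fix x y assume "x \<in> K" "norm (x - y) < r n"
      then show "y \<in> \<Omega> \<and> norm (g y - g x) \<le> \<omega>"
        using d1(2)[of x y] d2(2)[of x y] elim by (auto simp: dist_norm)
    qed
    also have "\<dots> \<le> 3 * (ennreal (e / 12) + ennreal (\<omega>\<^sup>2) * ennreal m + ennreal (e / 12))"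
    proof -
      have "3 * (a + b + a) \<le> 3 * (c + b + c)" if "a \<le> c" for a b c :: ennreal
        using that by (intro mult_left_mono add_mono) auto
      from this[OF g(2)] show ?thesis unfolding m(1) .
    qed
    also have "\<dots> = ennreal (3 * (e / 12 + \<omega>\<^sup>2 * m + e / 12))"
    proof -
      have "3 * (ennreal a + ennreal b * ennreal c + ennreal a) = ennreal (3 * (a + b * c + a))"
        if "a \<ge> 0" "b \<ge> 0" "c \<ge> 0" for a b c
        using that by (simp only: ennreal_mult ennreal_plus ennreal_numeral zero_le_numeral
            add_nonneg_nonneg mult_nonneg_nonneg)
      then show ?thesis using \<open>e > 0\<close> m(2) by simp
    qed
    also have "\<dots> \<le> ennreal e"
    proof (rule ennreal_leI)
      have "6 * (\<omega>\<^sup>2 * m) = e * (m / (m + 1))"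
        using m(2) by (simp add: \<omega>(2) field_simps)
      also have "\<dots> \<le> e * 1"
        using m(2) \<open>e > 0\<close> by (intro mult_left_mono) auto
      finally show "3 * (e / 12 + \<omega>\<^sup>2 * m + e / 12) \<le> e" by simp
    qed
    finally show ?case .
  qed
qed

text \<open>With errors \<open>a\<close> and \<open>b\<close>, the two bilinear values differ by the
  terms \<open>B x a b\<close>, \<open>B x a q\<close> and \<open>B x p b\<close>. Weighted Young
  inequalities put \<open>1 / e\<close> on the vanishing errors and \<open>e\<close> on the fixed
  norms of \<open>p\<close> and \<open>q\<close>, so \<open>n\<close> tends to infinity first and
  \<open>e\<close> to zero afterwards. The bound on \<open>B\<close> is asked almost everywhere
  because in the application it stems from an essentially bounded field.\<close>

lemma bilinear_integral_limit:
  fixes P Q :: "nat \<Rightarrow> real^'n \<Rightarrow> 'b::euclidean_space" and p q :: "real^'n \<Rightarrow> 'b"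
    and B :: "real^'n \<Rightarrow> 'b \<Rightarrow> 'b \<Rightarrow> real"
  assumes [measurable]: "\<And>n. P n \<in> borel_measurable lebesgue" "\<And>n. Q n \<in> borel_measurable lebesgue"
      "p \<in> borel_measurable lebesgue" "q \<in> borel_measurable lebesgue" "K \<in> sets lebesgue"
    and P: "(\<lambda>n. \<integral>\<^sup>+x. ennreal ((norm (P n x - p x))\<^sup>2) * indicator K x \<partial>lebesgue) \<longlonglongrightarrow> 0"
    and Q: "(\<lambda>n. \<integral>\<^sup>+x. ennreal ((norm (Q n x - q x))\<^sup>2) * indicator K x \<partial>lebesgue) \<longlonglongrightarrow> 0"
    and p: "(\<integral>\<^sup>+x. ennreal ((norm (p x))\<^sup>2) * indicator K x \<partial>lebesgue) < \<infinity>"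
    and q: "(\<integral>\<^sup>+x. ennreal ((norm (q x))\<^sup>2) * indicator K x \<partial>lebesgue) < \<infinity>"
    and bil: "\<And>x. bilinear (B x)" and "M \<ge> 0"
    and bound: "AE x in lebesgue. \<forall>a b. \<bar>B x a b\<bar> \<le> M * (norm a * norm b) * indicator K x"
    and int: "\<And>n. integrable lebesgue (\<lambda>x. B x (P n x) (Q n x))" "integrable lebesgue (\<lambda>x. B x (p x) (q x))"
    and zero: "eventually (\<lambda>n. (LINT x|lebesgue. B x (P n x) (Q n x)) = 0) sequentially"
  shows "(LINT x|lebesgue. B x (p x) (q x)) = 0"
proof -
  let ?I = "LINT x|lebesgue. B x (p x) (q x)"
  let ?P = "\<lambda>n. \<integral>\<^sup>+x. ennreal ((norm (P n x - p x))\<^sup>2) * indicator K x \<partial>lebesgue"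
  let ?Q = "\<lambda>n. \<integral>\<^sup>+x. ennreal ((norm (Q n x - q x))\<^sup>2) * indicator K x \<partial>lebesgue"
  let ?p = "\<integral>\<^sup>+x. ennreal ((norm (p x))\<^sup>2) * indicator K x \<partial>lebesgue"
  let ?q = "\<integral>\<^sup>+x. ennreal ((norm (q x))\<^sup>2) * indicator K x \<partial>lebesgue"
  obtain c where c: "?p + ?q = ennreal c" "c \<ge> 0"
  proof -
    have "?p + ?q < top" using p q by simp
    then obtain c where "?p + ?q = ennreal c" "c \<ge> 0" using less_top_ennreal by blast
    then show ?thesis by (rule that)
  qed
  \<comment> \<open>Young's inequality with weight \<open>e\<close>; adding the two extra squares
    gives up the usual factor 1/2 in exchange for simpler constants.\<close>
  have am: "x * y \<le> (1 / e) * x\<^sup>2 + e * y\<^sup>2" if "e > 0" "x \<ge> 0" "y \<ge> 0" for x y e :: real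
  proof -
    have "0 \<le> (x - e * y)\<^sup>2 + x\<^sup>2 + (e * y)\<^sup>2" by simp
    then have "e * (x * y) \<le> x\<^sup>2 + e\<^sup>2 * y\<^sup>2" by (simp add: power2_eq_square algebra_simps)
    then have "x * y \<le> (x\<^sup>2 + e\<^sup>2 * y\<^sup>2) / e" using that(1) by (simp add: pos_le_divide_eq mult.commute)
    also have "\<dots> = (1 / e) * x\<^sup>2 + e * y\<^sup>2" using that(1) by (simp add: field_simps power2_eq_square)
    finally show ?thesis .
  qed
  have ineq: "ennreal \<bar>?I\<bar> \<le> ennreal (M * (1 + 1 / e)) * (?P n + ?Q n) + ennreal (M * e * c)"
    if e: "e > 0" and z: "(LINT x|lebesgue. B x (P n x) (Q n x)) = 0" for e n
  proof -
    have "?I = (LINT x|lebesgue. B x (p x) (q x) - B x (P n x) (Q n x))"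
      using int z by simp
    then have "ennreal \<bar>?I\<bar> \<le> (\<integral>\<^sup>+x. ennreal (norm (B x (p x) (q x) - B x (P n x) (Q n x))) \<partial>lebesgue)"
      using integral_norm_bound_ennreal[OF Bochner_Integration.integrable_diff[OF int(2) int(1)[of n]]] by simp
    also have "\<dots> \<le> (\<integral>\<^sup>+x. ennreal (M * (1 + 1 / e)) * (ennreal ((norm (P n x - p x))\<^sup>2) * indicator K x
          + ennreal ((norm (Q n x - q x))\<^sup>2) * indicator K x)
          + ennreal (M * e) * (ennreal ((norm (p x))\<^sup>2) * indicator K x + ennreal ((norm (q x))\<^sup>2) * indicator K x) \<partial>lebesgue)"
    proof (rule nn_integral_mono_AE, use bound in eventually_elim)
      fix x assume bd: "\<forall>a b. \<bar>B x a b\<bar> \<le> M * (norm a * norm b) * indicator K x"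
      let ?a = "P n x - p x" and ?b = "Q n x - q x"
      have eq: "B x (p x) (q x) - B x (P n x) (Q n x) = - (B x ?a ?b + B x ?a (q x) + B x (p x) ?b)"
        by (simp add: bilinear_lsub[OF bil] bilinear_rsub[OF bil])
      show "ennreal (norm (B x (p x) (q x) - B x (P n x) (Q n x)))
        \<le> ennreal (M * (1 + 1 / e)) * (ennreal ((norm ?a)\<^sup>2) * indicator K x + ennreal ((norm ?b)\<^sup>2) * indicator K x)
          + ennreal (M * e) * (ennreal ((norm (p x))\<^sup>2) * indicator K x + ennreal ((norm (q x))\<^sup>2) * indicator K x)"
      proof (cases "x \<in> K")
        case True
        have bd': "\<bar>B x a b\<bar> \<le> M * (norm a * norm b)" for a b using bd True by simp
        have "norm (B x (p x) (q x) - B x (P n x) (Q n x))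
            \<le> M * (norm ?a * norm ?b) + M * (norm ?a * norm (q x)) + M * (norm (p x) * norm ?b)"
          unfolding eq using bd'[of ?a ?b] bd'[of ?a "q x"] bd'[of "p x" ?b] by simp
        also have "\<dots> = M * (norm ?a * norm ?b + norm ?a * norm (q x) + norm ?b * norm (p x))"
          by (simp add: algebra_simps)
        also have "\<dots> \<le> M * (((norm ?a)\<^sup>2 + (norm ?b)\<^sup>2)
            + ((1 / e) * (norm ?a)\<^sup>2 + e * (norm (q x))\<^sup>2) + ((1 / e) * (norm ?b)\<^sup>2 + e * (norm (p x))\<^sup>2))"
          using am[OF e, of "norm ?a" "norm (q x)"] am[OF e, of "norm ?b" "norm (p x)"] am[of 1 "norm ?a" "norm ?b"] \<open>M \<ge> 0\<close>
          by (intro mult_left_mono add_mono) auto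
        also have "\<dots> = M * (1 + 1 / e) * ((norm ?a)\<^sup>2 + (norm ?b)\<^sup>2) + M * e * ((norm (p x))\<^sup>2 + (norm (q x))\<^sup>2)"
          by (simp add: algebra_simps)
        finally have "ennreal (norm (B x (p x) (q x) - B x (P n x) (Q n x))) \<le> ennreal \<dots>"
          by (rule ennreal_leI)
        also have "\<dots> = ennreal (M * (1 + 1 / e)) * (ennreal ((norm ?a)\<^sup>2) + ennreal ((norm ?b)\<^sup>2))
          + ennreal (M * e) * (ennreal ((norm (p x))\<^sup>2) + ennreal ((norm (q x))\<^sup>2))"
          using e \<open>M \<ge> 0\<close> by (simp add: ennreal_mult)
        finally show ?thesis using True by simp
      next
        case False
        then show ?thesis unfolding eq using bd by simp
      qed
    qed
    also have "\<dots> = ennreal (M * (1 + 1 / e)) * (?P n + ?Q n) + ennreal (M * e) * (?p + ?q)"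
      by (subst nn_integral_add, measurable, (subst nn_integral_cmult, measurable, subst nn_integral_add, measurable)+)
    finally show ?thesis
      using e \<open>M \<ge> 0\<close> c by (simp add: ennreal_mult)
  qed
  have le: "\<bar>?I\<bar> \<le> M * e * c" if e: "e > 0" for e
  proof -
    \<comment> \<open>With \<open>e\<close> fixed, the large coefficient is a finite constant in
      front of errors that vanish; only the term proportional to \<open>e\<close> survives.\<close>
    have "(\<lambda>n. ennreal (M * (1 + 1 / e)) * (?P n + ?Q n) + ennreal (M * e * c))
       \<longlonglongrightarrow> ennreal (M * (1 + 1 / e)) * (0 + 0) + ennreal (M * e * c)"
      by (intro tendsto_add ennreal_tendsto_cmult P Q tendsto_const) simp
    then have "ennreal \<bar>?I\<bar> \<le> ennreal (M * (1 + 1 / e)) * (0 + 0) + ennreal (M * e * c)"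
      by (rule tendsto_lowerbound) (use zero in \<open>eventually_elim, use ineq[OF e] in simp\<close>, simp)
    then show ?thesis using e \<open>M \<ge> 0\<close> c by simp
  qed
  show ?thesis
  proof (rule ccontr)
    assume "?I \<noteq> 0"
    \<comment> \<open>Makes \<open>e * (M * c)\<close> strictly smaller than
      \<open>\<bar>?I\<bar>\<close>; the summand 1 keeps the denominator positive when
      \<open>M * c\<close> is zero.\<close>
    define e where "e = \<bar>?I\<bar> / (2 * (M * c + 1))"
    have pos: "M * c \<ge> 0" using \<open>M \<ge> 0\<close> c by simp
    then have "e > 0" using \<open>?I \<noteq> 0\<close> by (simp add: e_def)
    have "\<bar>?I\<bar> = 2 * e * (M * c + 1)" using pos by (simp add: e_def field_simps)
    moreover have "\<bar>?I\<bar> \<le> e * (M * c)" using le[OF \<open>e > 0\<close>] by (simp add: mult_ac)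
    moreover have "e * (M * c) \<ge> 0" using \<open>e > 0\<close> pos by simp
    ultimately show False using \<open>e > 0\<close> by (simp add: algebra_simps)
  qed
qed

section \<open>The Eshelby tensor\<close>

text \<open>The left-hand side of the claimed identity at one point, with \<open>Z\<close> in the
  place of the Jacobian. The stresses \<open>A\<close> and \<open>B\<close> are separate arguments,
  so that the algebra can be done before the law is inserted.\<close>

definition stress_form :: "real^3^3 \<Rightarrow> real^3^3 \<Rightarrow> real^3^3 \<Rightarrow> real^3^3 \<Rightarrow> real^3^3 \<Rightarrow> real" where
  "stress_form A B P Q Z = trace Z * (A \<bullet> Q) - A \<bullet> (Q ** Z) - B \<bullet> (P ** Z)"

text \<open>The divergence is taken along the first index, and the second index pairs with the
  components of the field; this is the reason for the transposed Jacobians in later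
  pairings.\<close>

definition eshelby :: "real \<Rightarrow> real \<Rightarrow> real^3^3 \<Rightarrow> real^3^3 \<Rightarrow> real^3^3" where
  "eshelby \<mu> l P Q = (isotropic \<mu> l P \<bullet> Q) *\<^sub>R mat 1
     - transpose (isotropic \<mu> l P) ** Q - transpose (isotropic \<mu> l Q) ** P"

text \<open>\<open>X \<bullet> (Y ** Z)\<close> is the trace of
  \<open>transpose X ** Y ** Z\<close>, so every summand is linear in \<open>Z\<close> and the
  coefficients can be collected in one matrix.\<close>

lemma stress_form_eq_sum:
  "stress_form A B P Q Z = (\<Sum>k\<in>UNIV. \<Sum>l\<in>UNIV.
     ((A \<bullet> Q) *\<^sub>R mat 1 - transpose A ** Q - transpose B ** P) $ k $ l * Z $ l $ k)"
proof -
  have inner: "X \<bullet> (Y ** Z) = (\<Sum>k\<in>UNIV. \<Sum>l\<in>UNIV. (transpose X ** Y) $ k $ l * Z $ l $ k)" for X Y :: "real^3^3"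
  proof -
    have "X \<bullet> (Y ** Z) = (\<Sum>i\<in>UNIV. \<Sum>k\<in>UNIV. \<Sum>l\<in>UNIV. X $ i $ k * Y $ i $ l * Z $ l $ k)"
      by (simp add: inner_vec_def matrix_matrix_mult_def sum_distrib_left mult.assoc)
    also have "\<dots> = (\<Sum>k\<in>UNIV. \<Sum>i\<in>UNIV. \<Sum>l\<in>UNIV. X $ i $ k * Y $ i $ l * Z $ l $ k)"
      by (rule sum.swap)
    also have "\<dots> = (\<Sum>k\<in>UNIV. \<Sum>l\<in>UNIV. \<Sum>i\<in>UNIV. X $ i $ k * Y $ i $ l * Z $ l $ k)"
      by (intro sum.cong refl sum.swap)
    finally show ?thesis
      by (simp add: matrix_matrix_mult_def transpose_def sum_distrib_right)
  qed
  have tr: "trace Z * c = (\<Sum>k\<in>UNIV. \<Sum>l\<in>UNIV. (c *\<^sub>R mat 1) $ k $ l * Z $ l $ k)" for c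
    by (simp add: trace_def mat_def if_distrib if_distribR sum_distrib_left mult.commute cong: if_cong)
  show ?thesis
    unfolding stress_form_def tr inner
    by (simp add: left_diff_distrib sum_subtractf)
qed

text \<open>For the dyad of \<open>u\<close> and \<open>\<xi>\<close> in the place of the Jacobian,
  the left-hand side becomes the vector \<open>b\<close> paired with \<open>\<xi>\<close>; thus both
  sides of the identity come from the same tensor. Contraction with a dyad produces the transposed
  stress, and symmetry turns it into the stress in \<open>b\<close>.\<close>

lemma stress_form_dyad:
  assumes "transpose A = A" "transpose B = B"
  shows "((A \<bullet> Q) *\<^sub>R u - A *v (Q *v u) - B *v (P *v u)) \<bullet> \<xi> = stress_form A B P Q (\<chi> i j. u $ i * \<xi> $ j)"
proof -
  have "A \<bullet> (Q ** (\<chi> i j. u $ i * \<xi> $ j)) = (A *v (Q *v u)) \<bullet> \<xi>"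
    if sym: "transpose A = A" for A Q :: "real^3^3"
  proof -
    have sym': "A $ i $ j = A $ j $ i" for i j
      using arg_cong[OF sym, of "\<lambda>M. M $ j $ i"] by (simp add: transpose_def)
    have "Q ** (\<chi> i j. u $ i * \<xi> $ j) = (\<chi> i j. (Q *v u) $ i * \<xi> $ j)"
      by (simp add: matrix_matrix_mult_def matrix_vector_mult_def vec_eq_iff sum_distrib_right mult.assoc)
    moreover have "A \<bullet> (\<chi> i j. v $ i * \<xi> $ j) = (A *v v) \<bullet> \<xi>" for v
    proof -
      have "A \<bullet> (\<chi> i j. v $ i * \<xi> $ j) = (\<Sum>j\<in>UNIV. \<Sum>i\<in>UNIV. A $ i $ j * v $ i * \<xi> $ j)"
        unfolding inner_vec_def by (subst sum.swap) (simp add: mult.assoc)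
      also have "\<dots> = (A *v v) \<bullet> \<xi>"
        by (simp add: sym'[of _ j for j] inner_vec_def matrix_vector_mult_def sum_distrib_right)
      finally show ?thesis .
    qed
    ultimately show ?thesis by simp
  qed
  moreover have "trace (\<chi> i j. u $ i * \<xi> $ j) = u \<bullet> \<xi>"
    by (simp add: trace_def inner_vec_def)
  ultimately show ?thesis using assms by (simp add: stress_form_def inner_diff_left mult.commute)
qed

section \<open>The isotropic law and bilinearity of the tensor\<close>

lemma isotropic_component:
  "isotropic \<mu> l A $ i $ j = \<mu> * (A $ i $ j + A $ j $ i) + l * (\<Sum>k\<in>UNIV. A $ k $ k) * (if i = j then 1 else 0)"
  by (simp add: isotropic_def sym_part_def trace_def transpose_def mat_def)

lemma bounded_linear_isotropic: "bounded_linear (isotropic \<mu> l)"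
  unfolding linear_conv_bounded_linear[symmetric]
  by (rule linearI) (simp_all add: vec_eq_iff isotropic_component sum.distrib algebra_simps sum_distrib_left)

lemma isotropic_symmetric: "isotropic \<mu> l A \<bullet> B = isotropic \<mu> l B \<bullet> A"
  unfolding inner_vec_def by (simp add: isotropic_component sum_3 algebra_simps)

lemma eshelby_commute: "eshelby \<mu> l P Q = eshelby \<mu> l Q P"
  by (simp add: eshelby_def isotropic_symmetric[of _ _ P Q])

lemma eshelby_component:
  "eshelby \<mu> l P Q $ k $ m = (if k = m then (\<Sum>i\<in>UNIV. \<Sum>j\<in>UNIV. isotropic \<mu> l P $ i $ j * Q $ i $ j) else 0)
     - (\<Sum>i\<in>UNIV. isotropic \<mu> l P $ i $ k * Q $ i $ m) - (\<Sum>i\<in>UNIV. isotropic \<mu> l Q $ i $ k * P $ i $ m)"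
  by (simp add: eshelby_def inner_vec_def mat_def matrix_matrix_mult_def transpose_def)

text \<open>Linearity is computed in the second argument; the exchange symmetry, a consequence of
  the major symmetry of the law, transfers it to the first.\<close>

lemma bounded_bilinear_eshelby: "bounded_bilinear (eshelby \<mu> l)"
proof -
  have lin: "linear (eshelby \<mu> l P)" for P
  proof (rule linearI)
    note lin = bounded_linear.linear[OF bounded_linear_isotropic[of \<mu> l]]
    show "eshelby \<mu> l P (A + B) = eshelby \<mu> l P A + eshelby \<mu> l P B" for A B
      by (simp add: vec_eq_iff eshelby_component linear_add[OF lin] algebra_simps sum.distrib)
    show "eshelby \<mu> l P (c *\<^sub>R A) = c *\<^sub>R eshelby \<mu> l P A" for A c
      by (simp add: vec_eq_iff eshelby_component linear_cmul[OF lin] algebra_simps sum_distrib_left)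
  qed
  then have "linear (\<lambda>P. eshelby \<mu> l P Q)" for Q
    by (subst eshelby_commute)
  with lin show ?thesis
    by (simp add: bilinear_conv_bounded_bilinear[symmetric] bilinear_def)
qed

text \<open>\<open>D k\<close> stands for the derivative in direction \<open>k\<close> of one
  gradient, while the other one is frozen at \<open>Q\<close>. The multiple of the identity
  contributes the stress of \<open>D m\<close> paired with \<open>Q\<close>. The differentiated
  stress in the second term is removed by the equation. By \<open>curl\<close> the third term is the
  stress of \<open>Q\<close> paired with \<open>D m\<close>, which by major symmetry cancels the
  first.\<close>

lemma eshelby_divergence_free:
  assumes curl: "\<And>i k m. D k $ i $ m = D m $ i $ k"
    and div: "\<And>i. (\<Sum>k\<in>UNIV. isotropic \<mu> l (D k) $ i $ k) = 0"
  shows "(\<Sum>k\<in>UNIV. eshelby \<mu> l (D k) Q $ k $ m) = 0"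
proof -
  let ?C = "isotropic \<mu> l"
  have "(\<Sum>k\<in>UNIV. eshelby \<mu> l (D k) Q $ k $ m)
     = ?C (D m) \<bullet> Q - (\<Sum>k\<in>UNIV. \<Sum>i\<in>UNIV. ?C (D k) $ i $ k * Q $ i $ m)
       - (\<Sum>k\<in>UNIV. \<Sum>i\<in>UNIV. ?C Q $ i $ k * D k $ i $ m)"
    by (simp add: eshelby_component sum_subtractf inner_vec_def)
  also have "(\<Sum>k\<in>UNIV. \<Sum>i\<in>UNIV. ?C (D k) $ i $ k * Q $ i $ m) = (\<Sum>i\<in>UNIV. (\<Sum>k\<in>UNIV. ?C (D k) $ i $ k) * Q $ i $ m)"
    by (subst sum.swap) (simp add: sum_distrib_right)
  also have "\<dots> = 0" by (simp add: div)
  also have "(\<Sum>k\<in>UNIV. \<Sum>i\<in>UNIV. ?C Q $ i $ k * D k $ i $ m) = ?C Q \<bullet> D m"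
    by (subst sum.swap) (simp add: inner_vec_def curl[of _ _ m])
  finally show ?thesis by (simp add: isotropic_symmetric[of _ _ Q])
qed

section \<open>The tensor of smooth fields\<close>

lemma smooth_fun_eshelby:
  assumes P: "\<And>i j. smooth_fun (\<lambda>x. P x $ i $ j)" and Q: "\<And>i j. smooth_fun (\<lambda>x. Q x $ i $ j)"
  shows "smooth_fun (\<lambda>x. eshelby \<mu> l (P x) (Q x) $ k $ m)"
proof -
  have iso: "smooth_fun (\<lambda>x. isotropic \<mu> l (R x) $ i $ j)"
    if "\<And>i j. smooth_fun (\<lambda>x. R x $ i $ j)" for R :: "real^'n \<Rightarrow> real^3^3" and i j
    unfolding isotropic_component
    by (intro smooth_fun_add smooth_fun_mult smooth_fun_sum smooth_fun_const that)
  have "smooth_fun (\<lambda>x. \<Sum>i\<in>UNIV. \<Sum>j\<in>UNIV. isotropic \<mu> l (P x) $ i $ j * Q x $ i $ j)"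
    by (intro smooth_fun_sum smooth_fun_mult iso P Q)
  then have "smooth_fun (\<lambda>x. if k = m then \<Sum>i\<in>UNIV. \<Sum>j\<in>UNIV. isotropic \<mu> l (P x) $ i $ j * Q x $ i $ j else 0)"
    by (cases "k = m") (simp_all add: smooth_fun_const)
  then show ?thesis unfolding eshelby_component
    by (intro smooth_fun_diff smooth_fun_sum smooth_fun_mult iso P Q)
qed

lemma has_derivative_matrix_fun:
  fixes P :: "real^'n \<Rightarrow> real^3^3"
  assumes "\<And>i j. smooth_fun (\<lambda>x. P x $ i $ j)"
  shows "(P has_derivative (\<lambda>v. \<chi> i j. \<Sum>k\<in>UNIV. v $ k * partial_deriv k (\<lambda>x. P x $ i $ j) x)) (at x)"
proof (subst has_derivative_componentwise_within, intro ballI)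
  fix b :: "real^3^3" assume "b \<in> Basis"
  then obtain i j where b: "b = axis i (axis j 1)" by (auto simp: Basis_vec_def)
  have "((\<lambda>x. P x $ i $ j) has_derivative (\<lambda>v. \<Sum>k\<in>UNIV. v $ k * partial_deriv k (\<lambda>x. P x $ i $ j) x)) (at x)"
    by (rule has_derivative_partials[OF smooth_fun_differentiable[OF assms]])
  then show "((\<lambda>x. P x \<bullet> b) has_derivative
     (\<lambda>v. (\<chi> i j. \<Sum>k\<in>UNIV. v $ k * partial_deriv k (\<lambda>x. P x $ i $ j) x) \<bullet> b)) (at x)"
    by (simp add: b inner_axis)
qed

text \<open>By the product rule the divergence has two parts, each with one gradient differentiated
  and the other frozen, and both vanish algebraically. All conditions concern the single point
  \<open>x\<close>, since smoothed solutions are known to satisfy them only where the kernel ball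
  lies in the region.\<close>

lemma eshelby_of_solutions_divergence_free:
  fixes P Q :: "real^3 \<Rightarrow> real^3^3"
  assumes smooth: "\<And>i j. smooth_fun (\<lambda>x. P x $ i $ j)" "\<And>i j. smooth_fun (\<lambda>x. Q x $ i $ j)"
    and curl: "\<And>i k m. partial_deriv k (\<lambda>x. P x $ i $ m) x = partial_deriv m (\<lambda>x. P x $ i $ k) x"
      "\<And>i k m. partial_deriv k (\<lambda>x. Q x $ i $ m) x = partial_deriv m (\<lambda>x. Q x $ i $ k) x"
    and div: "\<And>i. (\<Sum>k\<in>UNIV. partial_deriv k (\<lambda>x. isotropic \<mu> l (P x) $ i $ k) x) = 0"
      "\<And>i. (\<Sum>k\<in>UNIV. partial_deriv k (\<lambda>x. isotropic \<mu> l (Q x) $ i $ k) x) = 0"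
  shows "(\<Sum>k\<in>UNIV. partial_deriv k (\<lambda>x. eshelby \<mu> l (P x) (Q x) $ k $ m) x) = 0"
proof -
  let ?D = "\<lambda>R k. \<chi> i j. partial_deriv k (\<lambda>x. R x $ i $ j) x"
  have pd: "(\<chi> i j. \<Sum>k'\<in>UNIV. axis k 1 $ k' * partial_deriv k' (\<lambda>x. R x $ i $ j) x) = ?D R k"
    for R :: "real^3 \<Rightarrow> real^3^3" and k
    by (simp add: vec_eq_iff axis_def if_distrib if_distribR cong: if_cong)
  have iso: "partial_deriv k (\<lambda>x. isotropic \<mu> l (R x) $ i $ j) x = isotropic \<mu> l (?D R k) $ i $ j"
    if "\<And>i j. smooth_fun (\<lambda>x. R x $ i $ j)" for R :: "real^3 \<Rightarrow> real^3^3" and i j k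
  proof -
    have bl: "bounded_linear (\<lambda>A. isotropic \<mu> l A $ i $ j)"
      by (intro bounded_linear_compose[OF bounded_linear_vec_nth] bounded_linear_isotropic)
    show ?thesis
      using partial_deriv_eqI[OF bounded_linear.has_derivative[OF bl has_derivative_matrix_fun[OF that]]]
      by (simp only: pd)
  qed
  have esh: "partial_deriv k (\<lambda>x. eshelby \<mu> l (P x) (Q x) $ k $ m) x
      = eshelby \<mu> l (?D Q k) (P x) $ k $ m + eshelby \<mu> l (?D P k) (Q x) $ k $ m" for k
  proof -
    have "((\<lambda>x. eshelby \<mu> l (P x) (Q x)) has_derivative
       (\<lambda>v. eshelby \<mu> l (P x) (\<chi> i j. \<Sum>k\<in>UNIV. v $ k * partial_deriv k (\<lambda>x. Q x $ i $ j) x)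
         + eshelby \<mu> l (\<chi> i j. \<Sum>k\<in>UNIV. v $ k * partial_deriv k (\<lambda>x. P x $ i $ j) x) (Q x))) (at x)"
      by (intro bounded_bilinear.FDERIV[OF bounded_bilinear_eshelby] has_derivative_matrix_fun smooth)
    moreover have "bounded_linear (\<lambda>A::real^3^3. A $ k $ m)"
      by (intro bounded_linear_compose[OF bounded_linear_vec_nth] bounded_linear_vec_nth)
    ultimately have "((\<lambda>x. eshelby \<mu> l (P x) (Q x) $ k $ m) has_derivative
       (\<lambda>v. (eshelby \<mu> l (P x) (\<chi> i j. \<Sum>k\<in>UNIV. v $ k * partial_deriv k (\<lambda>x. Q x $ i $ j) x)
         + eshelby \<mu> l (\<chi> i j. \<Sum>k\<in>UNIV. v $ k * partial_deriv k (\<lambda>x. P x $ i $ j) x) (Q x)) $ k $ m)) (at x)"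
      using bounded_linear.has_derivative by blast
    from partial_deriv_eqI[OF this] show ?thesis
      by (simp only: pd vector_add_component eshelby_commute[of _ _ "P x" "?D Q k"])
  qed
  have "(\<Sum>k\<in>UNIV. eshelby \<mu> l (?D Q k) (P x) $ k $ m) = 0"
    using curl(2) div(2) iso[OF smooth(2)] by (intro eshelby_divergence_free) simp_all
  moreover have "(\<Sum>k\<in>UNIV. eshelby \<mu> l (?D P k) (Q x) $ k $ m) = 0"
    using curl(1) div(1) iso[OF smooth(1)] by (intro eshelby_divergence_free) simp_all
  ultimately show ?thesis by (simp add: esh sum.distrib)
qed

section \<open>Mollified solutions\<close>

lemma integrable_mult_test_function:
  fixes f :: "real^'n \<Rightarrow> real"
  assumes "locally_integrable_on f S" "test_function S \<psi>"
  shows "integrable lebesgue (\<lambda>x. \<psi> x * f x)"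
proof -
  let ?K = "closure {x. \<psi> x \<noteq> 0}"
  have "integrable lebesgue (\<lambda>x. indicator ?K x *\<^sub>R f x)"
    using assms by (simp add: locally_integrable_on_def test_function_def set_integrable_def)
  moreover have "\<psi> \<in> borel_measurable lebesgue"
    by (intro measurable_completion)
       (simp add: borel_measurable_continuous_onI smooth_fun_continuous test_function_smooth[OF assms(2)])
  moreover obtain B where "\<And>x. \<bar>\<psi> x\<bar> \<le> B" using test_function_bounded[OF assms(2)] by metis
  ultimately have "integrable lebesgue (\<lambda>x. \<psi> x *\<^sub>R (indicator ?K x *\<^sub>R f x))"
    by (rule integrable_bounded_scaleR[OF _ _ AE_I2])
  moreover have "(\<lambda>x. \<psi> x *\<^sub>R (indicator ?K x *\<^sub>R f x)) = (\<lambda>x. \<psi> x * f x)"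
    using closure_subset[of "{x. \<psi> x \<noteq> 0}"] by (auto simp: indicator_def fun_eq_iff)
  ultimately show ?thesis by metis
qed

text \<open>Every entry of \<open>H\<close> times \<open>\<phi>\<close> is a test function, so the
  weak derivatives of \<open>U\<close> may be tested with it. In the sum over all entries the
  derivatives falling on \<open>H\<close> form its divergence, multiplied by \<open>\<phi>\<close>;
  hence the condition where \<open>\<phi>\<close> is nonzero.\<close>

lemma divergence_free_against_weak_gradient:
  fixes H :: "real^'n \<Rightarrow> real^'m^'n" and U :: "real^'n \<Rightarrow> real^'m"
  assumes H: "\<And>k l. smooth_fun (\<lambda>x. H x $ k $ l)"
    and U: "has_weak_jacobian UNIV U DU" and \<phi>: "test_function UNIV \<phi>"
    and div: "\<And>x l. \<phi> x \<noteq> 0 \<Longrightarrow> (\<Sum>k\<in>UNIV. partial_deriv k (\<lambda>x. H x $ k $ l) x) = 0"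
  defines "w \<equiv> \<lambda>x. H x \<bullet> (\<chi> k l. partial_deriv k \<phi> x * U x $ l + \<phi> x * DU x $ l $ k)"
  shows "integrable lebesgue w" "(LINT x|lebesgue. w x) = 0"
proof -
  let ?t = "\<lambda>k l x. H x $ k $ l * \<phi> x"
  let ?I = "\<lambda>k l x. partial_deriv k (?t k l) x * U x $ l + ?t k l x * DU x $ l $ k"
  have t: "test_function UNIV (?t k l)" for k l
    by (rule test_function_mult[OF H \<phi>])
  have wp: "has_weak_partial UNIV k (\<lambda>x. U x $ l) (\<lambda>x. DU x $ l $ k)" for k l
    using U by (simp add: has_weak_jacobian_def)
  have int1: "integrable lebesgue (\<lambda>x. partial_deriv k (?t k l) x * U x $ l)" for k l
    using wp[of k l] by (intro integrable_mult_test_function[of _ UNIV] test_function_partial t)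
      (simp_all add: has_weak_partial_def)
  have int2: "integrable lebesgue (\<lambda>x. ?t k l x * DU x $ l $ k)" for k l
    using wp[of k l] by (intro integrable_mult_test_function[of _ UNIV] t)
      (simp_all add: has_weak_partial_def)
  have int0: "(LINT x|lebesgue. ?I k l x) = 0" for k l
  proof -
    have "(LINT x|lebesgue. U x $ l * partial_deriv k (?t k l) x) = - (LINT x|lebesgue. DU x $ l $ k * ?t k l x)"
      using wp[of k l] t[of k l] by (simp add: has_weak_partial_def set_lebesgue_integral_def)
    then show ?thesis
      using int1 int2 by (simp add: mult.commute)
  qed
  have pd: "partial_deriv k (?t k l) x = H x $ k $ l * partial_deriv k \<phi> x + partial_deriv k (\<lambda>x. H x $ k $ l) x * \<phi> x" for k l x
    using H \<phi> by (subst partial_deriv_mult) (auto intro: smooth_fun_differentiable test_function_smooth)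
  have w: "w = (\<lambda>x. \<Sum>k\<in>UNIV. \<Sum>l\<in>UNIV. ?I k l x)"
  proof
    fix x
    have "(\<Sum>k\<in>UNIV. \<Sum>l\<in>UNIV. partial_deriv k (\<lambda>x. H x $ k $ l) x * \<phi> x * U x $ l)
       = (\<Sum>l\<in>UNIV. (\<Sum>k\<in>UNIV. partial_deriv k (\<lambda>x. H x $ k $ l) x) * \<phi> x * U x $ l)"
      by (subst sum.swap) (simp add: sum_distrib_right)
    also have "\<dots> = 0" using div[of x] by (cases "\<phi> x = 0") auto
    finally show "w x = (\<Sum>k\<in>UNIV. \<Sum>l\<in>UNIV. ?I k l x)"
      by (simp add: w_def inner_vec_def pd distrib_left distrib_right sum.distrib mult.assoc)
  qed
  show "integrable lebesgue w"
    unfolding w by (intro Bochner_Integration.integrable_sum Bochner_Integration.integrable_add int1 int2)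
  show "(LINT x|lebesgue. w x) = 0"
    unfolding w using int0 int1 int2 by (simp add: Bochner_Integration.integral_sum)
qed

text \<open>The link between convolution and weak formulation: at a point whose kernel ball lies in
  \<open>S\<close>, the reflected kernel may be used for testing. The ball is closed, because the
  support must lie in a compact subset of \<open>S\<close>.\<close>

lemma test_function_reflect:
  assumes "test_function UNIV \<rho>" "\<And>z. norm z > r \<Longrightarrow> \<rho> z = 0" "\<And>y. norm (x - y) \<le> r \<Longrightarrow> y \<in> S"
  shows "test_function S (\<lambda>y. \<rho> (x - y))"
proof (rule test_functionI)
  show "smooth_fun (\<lambda>y. \<rho> (x - y))"
    using smooth_fun_affine[OF test_function_smooth[OF assms(1)], of x "-1"] by simp
  show "cball x r \<subseteq> S" using assms(3) by (auto simp: dist_norm)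
  show "\<rho> (x - y) = 0" if "y \<notin> cball x r" for y
    using that assms(2) by (simp add: dist_norm)
qed simp

lemma partial_deriv_reflect:
  assumes "smooth_fun \<rho>"
  shows "partial_deriv j (\<lambda>y. \<rho> (x - y)) y = - partial_deriv j \<rho> (x - y)"
  using partial_deriv_affine[OF smooth_fun_differentiable[OF assms], of j x "-1"] by (simp add: fun_eq_iff)

text \<open>The closure of the nonzero set may touch the sphere of radius \<open>r\<close>, so the
  argument is made strictly outside the ball.\<close>

lemma partial_deriv_outside_ball:
  assumes "\<And>z. norm z > r \<Longrightarrow> \<rho> z = 0" "norm z > r"
  shows "partial_deriv j \<rho> z = 0"
proof (rule partial_deriv_zero_outside_support)
  have "closure {z. \<rho> z \<noteq> 0} \<subseteq> cball 0 r"
    using assms(1) by (intro closure_minimal) (auto simp: not_less[symmetric])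
  with assms(2) show "z \<notin> closure {z. \<rho> z \<noteq> 0}" by auto
qed

lemma smooth_fun_convolution_component:
  fixes F :: "real^'n \<Rightarrow> real^'k^'m"
  assumes "test_function UNIV \<rho>" "integrable lebesgue F"
  shows "convolution \<rho> F x $ i $ j = convolution \<rho> (\<lambda>y. F y $ i $ j) x"
    "integrable lebesgue (\<lambda>y. F y $ i $ j)"
    "smooth_fun (\<lambda>x. convolution \<rho> F x $ i $ j)"
proof -
  have bl: "bounded_linear (\<lambda>A::real^'k^'m. A $ i $ j)"
    by (intro bounded_linear_compose[OF bounded_linear_vec_nth] bounded_linear_vec_nth)
  show eq: "convolution \<rho> F x $ i $ j = convolution \<rho> (\<lambda>y. F y $ i $ j) x" for x
    by (rule convolution_bounded_linear[OF bl assms])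
  show i: "integrable lebesgue (\<lambda>y. F y $ i $ j)"
    by (rule integrable_bounded_linear[OF bl assms(2)])
  show "smooth_fun (\<lambda>x. convolution \<rho> F x $ i $ j)"
    unfolding eq by (rule smooth_fun_convolution[OF assms(1) i])
qed

text \<open>One derivative reaches the kernel through the convolution, the other through the weak
  gradient of \<open>u\<close>, tested with the first partial of the kernel. What results is an
  integral of \<open>u\<close> against a mixed second partial of the kernel, which does not depend
  on the order.\<close>

lemma mollified_gradient_curl_free:
  fixes G :: "real^'n \<Rightarrow> real^'n^'m"
  assumes \<rho>: "test_function UNIV \<rho>" "\<And>z. norm z > r \<Longrightarrow> \<rho> z = 0" and near: "\<And>y. norm (x - y) \<le> r \<Longrightarrow> y \<in> \<Omega>"
    and u: "has_weak_jacobian \<Omega> u G"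
    and F: "F = (\<lambda>y. if y \<in> \<Omega> then G y else 0)" "integrable lebesgue F"
  shows "partial_deriv k (\<lambda>x. convolution \<rho> F x $ i $ m) x = partial_deriv m (\<lambda>x. convolution \<rho> F x $ i $ k) x"
proof -
  have eq: "partial_deriv k (\<lambda>x. convolution \<rho> F x $ i $ m) x
      = (LINT y:\<Omega>|lebesgue. u y $ i * partial_deriv m (partial_deriv k \<rho>) (x - y))" for k m
  proof -
    have "partial_deriv k (\<lambda>x. convolution \<rho> F x $ i $ m) x = convolution (partial_deriv k \<rho>) (\<lambda>y. F y $ i $ m) x"
      unfolding smooth_fun_convolution_component(1)[OF \<rho>(1) F(2)]
      by (rule partial_deriv_convolution[OF \<rho>(1) smooth_fun_convolution_component(2)[OF \<rho>(1) F(2)]])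
    also have "\<dots> = (LINT y:\<Omega>|lebesgue. G y $ i $ m * partial_deriv k \<rho> (x - y))"
      unfolding convolution_def set_lebesgue_integral_def F(1)
      by (intro Bochner_Integration.integral_cong) auto
    also have "\<dots> = - (LINT y:\<Omega>|lebesgue. u y $ i * partial_deriv m (\<lambda>y. partial_deriv k \<rho> (x - y)) y)"
    proof -
      have "test_function \<Omega> (\<lambda>y. partial_deriv k \<rho> (x - y))"
        by (rule test_function_reflect[OF test_function_partial[OF \<rho>(1)] partial_deriv_outside_ball[OF \<rho>(2)] near])
      then show ?thesis using u by (simp add: has_weak_jacobian_def has_weak_partial_def)
    qed
    \<comment> \<open>The sign from the weak derivative and the sign from the reflection
      cancel.\<close>
    also have "\<dots> = (LINT y:\<Omega>|lebesgue. u y $ i * partial_deriv m (partial_deriv k \<rho>) (x - y))"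
      by (simp add: partial_deriv_reflect[OF smooth_fun_partial[OF test_function_smooth[OF \<rho>(1)]]]
          set_lebesgue_integral_def)
    finally show ?thesis .
  qed
  show ?thesis
    unfolding eq partial_deriv_commute[OF test_function_smooth[OF \<rho>(1)], of m k] ..
qed

text \<open>A linear law with constant coefficients commutes with convolution, so the divergence of
  the smoothed stress is the equation tested with the reflected kernel. The kernel ball has to lie
  in \<open>S\<close> and not just in \<open>\<Omega>\<close>, since \<open>C\<close> is known to be
  this law on \<open>S\<close> only.\<close>

lemma mollified_stress_divergence_free:
  fixes G :: "real^3 \<Rightarrow> real^3^3"
  assumes \<rho>: "test_function UNIV \<rho>" "\<And>z. norm z > r \<Longrightarrow> \<rho> z = 0" and near: "\<And>y. norm (x - y) \<le> r \<Longrightarrow> y \<in> S"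
    and S: "S \<subseteq> \<Omega>" and C: "\<And>y A. y \<in> S \<Longrightarrow> C y A = isotropic \<mu> l A"
    and div: "has_weak_div_matrix \<Omega> (\<lambda>y. C y (G y)) (\<lambda>y. 0)"
    and F: "F = (\<lambda>y. if y \<in> \<Omega> then G y else 0)" "integrable lebesgue F"
  shows "(\<Sum>k\<in>UNIV. partial_deriv k (\<lambda>x. isotropic \<mu> l (convolution \<rho> F x) $ i $ k) x) = 0"
proof -
  let ?c = "\<lambda>k y. isotropic \<mu> l (F y) $ i $ k"
  let ?d = "\<lambda>y. \<chi> j. partial_deriv j (\<lambda>y. \<rho> (x - y)) y"
  have bl: "bounded_linear (\<lambda>A. isotropic \<mu> l A $ i $ k)" for k
    by (intro bounded_linear_compose[OF bounded_linear_vec_nth] bounded_linear_isotropic)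
  have int: "integrable lebesgue (?c k)" for k
    by (rule integrable_bounded_linear[OF bl F(2)])
  have test: "test_function \<Omega> (\<lambda>y. \<rho> (x - y))"
    using test_function_mono[OF test_function_reflect[OF \<rho> near] S] .
  have "(\<Sum>k\<in>UNIV. partial_deriv k (\<lambda>x. isotropic \<mu> l (convolution \<rho> F x) $ i $ k) x)
      = (\<Sum>k\<in>UNIV. convolution (partial_deriv k \<rho>) (?c k) x)"
    unfolding convolution_bounded_linear[OF bl \<rho>(1) F(2)] partial_deriv_convolution[OF \<rho>(1) int] ..
  also have "\<dots> = (LINT y|lebesgue. (\<Sum>k\<in>UNIV. partial_deriv k \<rho> (x - y) * ?c k y))"
    using convolution_integrable[OF test_function_partial[OF \<rho>(1)] int]
    by (simp add: convolution_def Bochner_Integration.integral_sum)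
  also have "\<dots> = (LINT y:\<Omega>|lebesgue. - ((C y (G y) $ i) \<bullet> ?d y))"
    unfolding set_lebesgue_integral_def
  proof (intro Bochner_Integration.integral_cong refl)
    fix y
    show "(\<Sum>k\<in>UNIV. partial_deriv k \<rho> (x - y) * ?c k y) = indicat_real \<Omega> y *\<^sub>R - (C y (G y) $ i \<bullet> ?d y)"
    proof (cases "norm (x - y) \<le> r")
      case True
      then have y: "y \<in> S" "y \<in> \<Omega>" using near S by auto
      then show ?thesis
        by (simp add: C F(1) partial_deriv_reflect[OF test_function_smooth[OF \<rho>(1)]] inner_vec_def
            sum_negf mult.commute)
    next
      \<comment> \<open>Off the ball all partials of the kernel vanish, so both integrands are zero
        whatever law \<open>C y\<close> follows there.\<close>
      case False
      then have "partial_deriv j \<rho> (x - y) = 0" for j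
        using partial_deriv_outside_ball[of r \<rho>] \<rho>(2) by simp
      then show ?thesis
        by (simp add: partial_deriv_reflect[OF test_function_smooth[OF \<rho>(1)]] inner_vec_def)
    qed
  qed
  also have "\<dots> = - (LINT y:\<Omega>|lebesgue. (C y (G y) $ i) \<bullet> ?d y)"
    by (simp add: set_lebesgue_integral_def)
  also have "\<dots> = 0"
    using div test by (simp add: has_weak_div_matrix_def has_weak_div_def set_lebesgue_integral_def)
  finally show ?thesis .
qed

section \<open>Passage to the limit\<close>

lemma borel_measurable_bilinear:
  fixes T :: "'a::euclidean_space \<Rightarrow> 'b::euclidean_space \<Rightarrow> 'c::euclidean_space"
  assumes T: "bounded_bilinear T" and "f \<in> borel_measurable M" "g \<in> borel_measurable M"
  shows "(\<lambda>x. T (f x) (g x)) \<in> borel_measurable M"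
  using assms(2,3)
  by (rule borel_measurable_continuous_Pair)
     (intro bounded_bilinear.continuous_on[OF T] continuous_intros)

lemma norm_matrix_le_sum: "norm (A :: real^'n^'m) \<le> (\<Sum>i\<in>UNIV. \<Sum>j\<in>UNIV. \<bar>A $ i $ j\<bar>)"
proof -
  have "norm A \<le> (\<Sum>i\<in>UNIV. norm (A $ i))" unfolding norm_vec_def by (rule L2_set_le_sum) simp
  also have "\<dots> \<le> (\<Sum>i\<in>UNIV. \<Sum>j\<in>UNIV. \<bar>A $ i $ j\<bar>)" by (intro sum_mono norm_le_l1_cart)
  finally show ?thesis .
qed

lemma borel_measurable_matrix:
  fixes R :: "'a \<Rightarrow> real^'n^'m"
  assumes "\<And>i j. (\<lambda>x. R x $ i $ j) \<in> borel_measurable M"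
  shows "R \<in> borel_measurable M"
proof (subst borel_measurable_euclidean_space, intro ballI)
  fix b :: "real^'n^'m" assume "b \<in> Basis"
  then obtain i j where "b = axis i (axis j 1)" by (auto simp: Basis_vec_def)
  then show "(\<lambda>x. R x \<bullet> b) \<in> borel_measurable M" using assms by (simp add: inner_axis)
qed

text \<open>The product of two square integrable gradients is integrable and remains so when paired
  with an essentially bounded factor. \<open>T\<close> is left open to cover the inner product of
  the weak identities and the matrix-vector product in \<open>b\<close>.\<close>

lemma integrable_eshelby_pairing:
  fixes P Q :: "'a \<Rightarrow> real^3^3" and R :: "'a \<Rightarrow> 'b::euclidean_space"
    and T :: "real^3^3 \<Rightarrow> 'b \<Rightarrow> 'c::euclidean_space"
  assumes T: "bounded_bilinear T"
    and P: "P \<in> borel_measurable M" "integrable M (\<lambda>x. (norm (P x))\<^sup>2)"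
    and Q: "Q \<in> borel_measurable M" "integrable M (\<lambda>x. (norm (Q x))\<^sup>2)"
    and R: "R \<in> borel_measurable M" "AE x in M. norm (R x) \<le> B"
  shows "integrable M (\<lambda>x. T (eshelby \<mu> l (P x) (Q x)) (R x))"
proof -
  obtain k1 where k1: "0 \<le> k1" "\<And>a b. norm (T a b) \<le> norm a * norm b * k1"
    using bounded_bilinear.nonneg_bounded[OF T] by blast
  obtain k2 where k2: "0 \<le> k2" "\<And>a b. norm (eshelby \<mu> l a b) \<le> norm a * norm b * k2"
    using bounded_bilinear.nonneg_bounded[OF bounded_bilinear_eshelby[of \<mu> l]] by blast
  show ?thesis
  proof (rule Bochner_Integration.integrable_bound)
    show "integrable M (\<lambda>x. k2 * \<bar>B\<bar> * k1 * ((norm (P x))\<^sup>2 + (norm (Q x))\<^sup>2))"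
      using P Q by (intro integrable_mult_right Bochner_Integration.integrable_add)
    show "(\<lambda>x. T (eshelby \<mu> l (P x) (Q x)) (R x)) \<in> borel_measurable M"
      by (intro borel_measurable_bilinear[OF T] borel_measurable_bilinear[OF bounded_bilinear_eshelby] P Q R)
    show "AE x in M. norm (T (eshelby \<mu> l (P x) (Q x)) (R x))
       \<le> norm (k2 * \<bar>B\<bar> * k1 * ((norm (P x))\<^sup>2 + (norm (Q x))\<^sup>2))"
      using R(2)
    proof eventually_elim
      fix x assume R: "norm (R x) \<le> B"
      have "norm (P x) * norm (Q x) \<le> (norm (P x))\<^sup>2 + (norm (Q x))\<^sup>2"
      proof -
        have "0 \<le> (norm (P x) - norm (Q x))\<^sup>2 + (norm (P x))\<^sup>2 + (norm (Q x))\<^sup>2" by simp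
        then show ?thesis by (simp add: power2_eq_square algebra_simps)
      qed
      have "norm (T (eshelby \<mu> l (P x) (Q x)) (R x)) \<le> norm (eshelby \<mu> l (P x) (Q x)) * norm (R x) * k1"
        by (rule k1)
      also have "\<dots> \<le> (((norm (P x))\<^sup>2 + (norm (Q x))\<^sup>2) * k2) * \<bar>B\<bar> * k1"
      proof (intro mult_right_mono mult_mono k1(1))
        show "norm (eshelby \<mu> l (P x) (Q x)) \<le> ((norm (P x))\<^sup>2 + (norm (Q x))\<^sup>2) * k2"
          using k2(2)[of "P x" "Q x"] \<open>norm (P x) * norm (Q x) \<le> _\<close> k2(1)
          by (intro order_trans[OF k2(2)] mult_right_mono)
      qed (use R k2 in auto)
      finally show "norm (T (eshelby \<mu> l (P x) (Q x)) (R x))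
          \<le> norm (k2 * \<bar>B\<bar> * k1 * ((norm (P x))\<^sup>2 + (norm (Q x))\<^sup>2))"
        using k1(1) k2(1) by (simp add: mult_ac)
    qed
  qed
qed

section \<open>Zero extensions and continuous approximants of the gradients\<close>

lemma open_in_lebesgue: "open S \<Longrightarrow> S \<in> sets lebesgue"
  by (rule sets_completionI_sets) (simp add: borel_open)

text \<open>Convolution asks for an integrable field on the whole space. Since
  \<open>\<Omega>\<close> has finite measure, square integrability gives integrability through
  \<open>t \<le> 1 + t\<^sup>2\<close>.\<close>

lemma zero_extension_L2:
  fixes G :: "'a::euclidean_space \<Rightarrow> 'b::euclidean_space"
  assumes \<Omega>: "open \<Omega>" "bounded \<Omega>" and G: "square_integrable (lebesgue_on \<Omega>) G"
    and F: "F = (\<lambda>x. if x \<in> \<Omega> then G x else 0)"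
  shows "F \<in> borel_measurable lebesgue" "integrable lebesgue (\<lambda>x. (norm (F x))\<^sup>2)" "integrable lebesgue F"
proof -
  have s: "\<Omega> \<in> sets lebesgue" by (rule open_in_lebesgue[OF \<Omega>(1)])
  show m: "F \<in> borel_measurable lebesgue"
    unfolding F using G s by (subst borel_measurable_if) (simp_all add: square_integrable_def)
  have "integrable lebesgue (\<lambda>x. indicator \<Omega> x *\<^sub>R (norm (G x))\<^sup>2)"
    using G s by (subst integrable_restrict_space[symmetric]) (simp_all add: square_integrable_def)
  moreover have "(\<lambda>x. indicator \<Omega> x *\<^sub>R (norm (G x))\<^sup>2) = (\<lambda>x. (norm (F x))\<^sup>2)"
    by (auto simp: F fun_eq_iff)
  ultimately show i: "integrable lebesgue (\<lambda>x. (norm (F x))\<^sup>2)" by simp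
  show "integrable lebesgue F"
  proof (rule Bochner_Integration.integrable_bound[OF _ m])
    have "integrable lebesgue (indicator \<Omega> :: 'a \<Rightarrow> real)"
      using fmeasurableD2[OF lmeasurable_open[OF \<Omega>(2,1)]] s
      by (intro integrable_real_indicator) (simp_all add: less_top)
    then show "integrable lebesgue (\<lambda>x. indicator \<Omega> x + (norm (F x))\<^sup>2)"
      using i by (rule Bochner_Integration.integrable_add)
    have "norm (F x) \<le> indicator \<Omega> x + (norm (F x))\<^sup>2" for x
    proof (cases "x \<in> \<Omega>")
      case True
      have "0 \<le> (norm (F x) - 1)\<^sup>2 + (norm (F x))\<^sup>2 + 1" by simp
      with True show ?thesis by (simp add: power2_eq_square algebra_simps)
    qed (simp add: F)
    then show "AE x in lebesgue. norm (F x) \<le> norm (indicator \<Omega> x + (norm (F x))\<^sup>2)"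
      by (intro AE_I2) (simp add: abs_of_nonneg[OF add_nonneg_nonneg])
  qed
qed

lemma continuous_jacobian_matrix:
  fixes f :: "real^'n \<Rightarrow> real^'m"
  assumes "\<And>i. smooth_fun (\<lambda>x. f x $ i)"
  shows "continuous_on UNIV (\<lambda>x. matrix (frechet_derivative f (at x)))"
proof -
  have "(f has_derivative (\<lambda>v. \<chi> i. \<Sum>k\<in>UNIV. v $ k * partial_deriv k (\<lambda>x. f x $ i) x)) (at x)" for x
  proof (subst has_derivative_componentwise_within, intro ballI)
    fix b :: "real^'m" assume "b \<in> Basis"
    then obtain i where b: "b = axis i 1" by (auto simp: Basis_vec_def)
    show "((\<lambda>x. f x \<bullet> b) has_derivative
       (\<lambda>v. (\<chi> i. \<Sum>k\<in>UNIV. v $ k * partial_deriv k (\<lambda>x. f x $ i) x) \<bullet> b)) (at x)"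
      using has_derivative_partials[OF smooth_fun_differentiable[OF assms[of i]]]
      by (simp add: b inner_axis)
  qed
  then have "frechet_derivative f (at x) = (\<lambda>v. \<chi> i. \<Sum>k\<in>UNIV. v $ k * partial_deriv k (\<lambda>x. f x $ i) x)" for x
    by (rule frechet_derivative_at[symmetric])
  then have "(\<lambda>x. matrix (frechet_derivative f (at x))) = (\<lambda>x. \<chi> i j. partial_deriv j (\<lambda>x. f x $ i) x)"
    by (simp add: matrix_def axis_def if_distrib if_distribR fun_eq_iff vec_eq_iff cong: if_cong)
  then show ?thesis
    by (simp only:) (intro continuous_on_vec_lambda smooth_fun_continuous smooth_fun_partial assms)
qed

text \<open>The trace condition comes with smooth maps that converge to \<open>u\<close> in
  \<open>H1\<close>; their Jacobians are the continuous approximants required for the convergence of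
  mollifications.\<close>

lemma has_trace_gradient_approximable:
  assumes "open S" "has_trace S u G f" "e > (0::real)"
  shows "\<exists>g. continuous_on UNIV g \<and>
    (\<integral>\<^sup>+x. ennreal ((norm ((if x \<in> S then G x else 0) - g x))\<^sup>2) * indicator S x \<partial>lebesgue) \<le> ennreal e"
proof -
  obtain \<Phi> :: "nat \<Rightarrow> real^3 \<Rightarrow> real^3" where \<Phi>: "\<And>n i. smooth_fun (\<lambda>x. \<Phi> n x $ i)"
    "(\<lambda>n. \<integral>\<^sup>+x. ennreal ((norm (matrix (frechet_derivative (\<Phi> n) (at x)) - G x))\<^sup>2) \<partial>lebesgue_on S) \<longlonglongrightarrow> 0"
    using assms(2) unfolding has_trace_def by auto
  have "eventually (\<lambda>n. (\<integral>\<^sup>+x. ennreal ((norm (matrix (frechet_derivative (\<Phi> n) (at x)) - G x))\<^sup>2) \<partial>lebesgue_on S) < ennreal e) sequentially"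
    using order_tendstoD(2)[OF \<Phi>(2)] assms(3) by simp
  then obtain n where n: "(\<integral>\<^sup>+x. ennreal ((norm (matrix (frechet_derivative (\<Phi> n) (at x)) - G x))\<^sup>2) \<partial>lebesgue_on S) < ennreal e"
    by (auto simp: eventually_sequentially)
  let ?g = "\<lambda>x. matrix (frechet_derivative (\<Phi> n) (at x))"
  have "(\<integral>\<^sup>+x. ennreal ((norm ((if x \<in> S then G x else 0) - ?g x))\<^sup>2) * indicator S x \<partial>lebesgue)
     = (\<integral>\<^sup>+x. ennreal ((norm (?g x - G x))\<^sup>2) \<partial>lebesgue_on S)"
    using open_in_lebesgue[OF assms(1)]
    by (subst nn_integral_restrict_space)
       (auto intro!: nn_integral_cong simp: norm_minus_commute indicator_def)
  then show ?thesis
    using n continuous_jacobian_matrix[OF \<Phi>(1)] by (intro exI[of _ ?g]) simp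
qed

section \<open>The limit of the mollified identity\<close>

lemma borel_measurable_convolution:
  fixes F :: "real^'n \<Rightarrow> real^3^3"
  assumes "test_function UNIV \<rho>" "integrable lebesgue F"
  shows "convolution \<rho> F \<in> borel_measurable lebesgue"
proof (rule borel_measurable_matrix)
  fix i j
  have "(\<lambda>x. convolution \<rho> F x $ i $ j) \<in> borel_measurable borel"
    by (intro borel_measurable_continuous_onI smooth_fun_continuous smooth_fun_convolution_component(3) assms)
  then show "(\<lambda>x. convolution \<rho> F x $ i $ j) \<in> borel_measurable lebesgue"
    by (intro measurable_completion) simp
qed

text \<open>The weights are independent of each other so that the lemma covers the whole derivative
  of \<open>\<phi> U\<close> and, with one weight equal to zero, each of its two halves.\<close>

lemma weighted_field_measurable_bounded:
  fixes U :: "real^'n \<Rightarrow> real^'m"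
  assumes U: "W1inf_with_jacobian U DU" and \<alpha>: "\<And>k. test_function UNIV (\<alpha> k)" and \<beta>: "test_function UNIV \<beta>"
  defines "W \<equiv> \<lambda>x. \<chi> k m. \<alpha> k x * U x $ m + \<beta> x * DU x $ m $ k"
  shows "W \<in> borel_measurable lebesgue" "\<exists>M. AE x in lebesgue. norm (W x) \<le> M"
proof -
  have loc: "locally_integrable_on (\<lambda>x. U x $ m) UNIV" "locally_integrable_on (\<lambda>x. DU x $ m $ k) UNIV" for k m
    using U by (simp_all add: W1inf_with_jacobian_def has_weak_jacobian_def has_weak_partial_def)
  show "W \<in> borel_measurable lebesgue"
  proof (rule borel_measurable_matrix)
    fix k m
    have "integrable lebesgue (\<lambda>x. \<alpha> k x * U x $ m)" "integrable lebesgue (\<lambda>x. \<beta> x * DU x $ m $ k)"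
      by (rule integrable_mult_test_function[OF loc(1) \<alpha>] integrable_mult_test_function[OF loc(2) \<beta>])+
    then show "(\<lambda>x. W x $ k $ m) \<in> borel_measurable lebesgue"
      by (simp add: W_def)
  qed
  obtain M where M: "AE x in lebesgue. norm (U x) \<le> M \<and> norm (DU x) \<le> M"
    using U by (auto simp: W1inf_with_jacobian_def)
  have "\<exists>a. a \<ge> 0 \<and> (\<forall>x. \<bar>\<alpha> k x\<bar> \<le> a)" for k
    using test_function_bounded[OF \<alpha>[of k]] by metis
  then obtain a where a: "\<And>k. a k \<ge> 0" "\<And>k x. \<bar>\<alpha> k x\<bar> \<le> a k" by metis
  obtain b where b: "b \<ge> 0" "\<And>x. \<bar>\<beta> x\<bar> \<le> b" using test_function_bounded[OF \<beta>] by metis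
  have "AE x in lebesgue. norm (W x) \<le> (\<Sum>k\<in>(UNIV::'n set). \<Sum>m\<in>(UNIV::'m set). a k * M + b * M)"
    using M
  proof eventually_elim
    case (elim x)
    have "\<bar>W x $ k $ m\<bar> \<le> a k * M + b * M" for k m
    proof -
      have "\<bar>U x $ m\<bar> \<le> M" using component_le_norm_cart[of "U x" m] elim by simp
      moreover have "\<bar>DU x $ m $ k\<bar> \<le> M"
        using component_le_norm_cart[of "DU x $ m" k] Finite_Cartesian_Product.norm_nth_le[of "DU x" m] elim by simp
      ultimately have "\<bar>\<alpha> k x * U x $ m\<bar> \<le> a k * M" "\<bar>\<beta> x * DU x $ m $ k\<bar> \<le> b * M"
        using a b by (auto simp: abs_mult intro!: mult_mono)
      then show ?thesis by (simp add: W_def)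
    qed
    then show ?case by (intro order_trans[OF norm_matrix_le_sum] sum_mono)
  qed
  then show "\<exists>M. AE x in lebesgue. norm (W x) \<le> M" by blast
qed

text \<open>The matrix in the pairing is the transposed weak Jacobian of \<open>\<phi> U\<close>. It
  stays fixed while the gradients are smoothed, so the integrand is a bilinear form in the two
  gradients with an essentially bounded coefficient supported in a compact set.\<close>

lemma eshelby_weakly_divergence_free:
  fixes Gu Gv :: "real^3 \<Rightarrow> real^3^3"
  assumes \<Omega>: "open \<Omega>" "bounded \<Omega>" and S: "open S" "S \<subseteq> \<Omega>"
    and C: "\<And>y A. y \<in> S \<Longrightarrow> C y A = isotropic \<mu> l A"
    and u: "H1_with_gradient \<Omega> u Gu" "has_weak_div_matrix \<Omega> (\<lambda>y. C y (Gu y)) (\<lambda>y. 0)"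
    and v: "H1_with_gradient \<Omega> v Gv" "has_weak_div_matrix \<Omega> (\<lambda>y. C y (Gv y)) (\<lambda>y. 0)"
    and approx_u: "\<And>e::real. e > 0 \<Longrightarrow> \<exists>g. continuous_on UNIV g \<and>
       (\<integral>\<^sup>+x. ennreal ((norm ((if x \<in> \<Omega> then Gu x else 0) - g x))\<^sup>2) * indicator \<Omega> x \<partial>lebesgue) \<le> ennreal e"
    and approx_v: "\<And>e::real. e > 0 \<Longrightarrow> \<exists>g. continuous_on UNIV g \<and>
       (\<integral>\<^sup>+x. ennreal ((norm ((if x \<in> \<Omega> then Gv x else 0) - g x))\<^sup>2) * indicator \<Omega> x \<partial>lebesgue) \<le> ennreal e"
    and U: "W1inf_with_jacobian U DU" and \<phi>: "test_function S \<phi>"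
    and Fu: "Fu = (\<lambda>y. if y \<in> \<Omega> then Gu y else 0)" and Fv: "Fv = (\<lambda>y. if y \<in> \<Omega> then Gv y else 0)"
  shows "(LINT x|lebesgue. eshelby \<mu> l (Fu x) (Fv x) \<bullet>
    (\<chi> k m. partial_deriv k \<phi> x * U x $ m + \<phi> x * DU x $ m $ k)) = 0"
proof (cases "\<exists>x. \<phi> x \<noteq> 0")
  \<comment> \<open>Treated apart, because the kernels below are built from a point where
    \<open>\<phi>\<close> is nonzero.\<close>
  case False
  then have "\<phi> = (\<lambda>_. 0)" by auto
  then have "(\<chi> k m. partial_deriv k \<phi> x * U x $ m + \<phi> x * DU x $ m $ k) = 0" for x
    by (simp add: partial_deriv_const vec_eq_iff)
  then show ?thesis by simp
next
  case True
  then obtain x0 where x0: "\<phi> x0 \<noteq> 0" by blast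
  let ?K = "closure {x. \<phi> x \<noteq> 0}"
  let ?W = "\<lambda>x. \<chi> k m. partial_deriv k \<phi> x * U x $ m + \<phi> x * DU x $ m $ k"
  have K: "compact ?K" "?K \<subseteq> S" using \<phi> by (auto simp: test_function_def)
  have \<phi>': "test_function UNIV \<phi>" using test_function_mono[OF \<phi>] by simp
  obtain d where d: "d > 0" "\<And>x y. x \<in> ?K \<Longrightarrow> norm (x - y) < d \<Longrightarrow> y \<in> S"
    using compact_near_open[OF K(1) S(1) K(2)] by blast
  \<comment> \<open>The shift by 2 keeps every radius strictly below \<open>d\<close>, already for
    \<open>n = 0\<close>, so closed kernel balls centred in the support stay in
    \<open>S\<close>.\<close>
  define r where "r n = d / real (n + 2)" for n
  have r: "r n > 0" "r n < d" for n
    using d(1) divide_strict_left_mono[of 1 "real (n + 2)" d] by (simp_all add: r_def)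
  have r0: "r \<longlonglongrightarrow> 0"
    unfolding r_def by (rule LIMSEQ_ignore_initial_segment[OF lim_const_over_n])
  obtain \<rho> :: "nat \<Rightarrow> real^3 \<Rightarrow> real" where \<rho>: "\<And>n. mollifier (r n) (\<rho> n)"
    using mollifier_exists[OF \<phi> x0 r(1)] by metis
  have \<rho>0: "\<rho> n z = 0" if "norm z > r n" for n z using mollifierD(3)[OF \<rho>] that by simp
  note \<rho>t = mollifierD(1)[OF \<rho>]
  have sq: "square_integrable (lebesgue_on \<Omega>) Gu" "square_integrable (lebesgue_on \<Omega>) Gv"
    "has_weak_jacobian \<Omega> u Gu" "has_weak_jacobian \<Omega> v Gv"
    using u(1) v(1) by (simp_all add: H1_with_gradient_def)
  note Fu' = zero_extension_L2[OF \<Omega> sq(1) Fu] and Fv' = zero_extension_L2[OF \<Omega> sq(2) Fv]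
  let ?P = "\<lambda>n. convolution (\<rho> n) Fu" and ?Q = "\<lambda>n. convolution (\<rho> n) Fv"
  have near: "y \<in> S" "y \<in> \<Omega>" if "x \<in> ?K" "norm (x - y) \<le> r n" for x y n
    using d(2)[OF that(1), of y] that(2) r(2)[of n] S(2) by auto
  have smooth: "smooth_fun (\<lambda>x. ?P n x $ i $ j)" "smooth_fun (\<lambda>x. ?Q n x $ i $ j)" for n i j
    by (rule smooth_fun_convolution_component(3)[OF \<rho>t Fu'(3)] smooth_fun_convolution_component(3)[OF \<rho>t Fv'(3)])+
  have div: "(\<Sum>k\<in>UNIV. partial_deriv k (\<lambda>x. eshelby \<mu> l (?P n x) (?Q n x) $ k $ m) x) = 0"
    if "\<phi> x \<noteq> 0" for n m x
  proof (rule eshelby_of_solutions_divergence_free[OF smooth])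
    have x: "x \<in> ?K" using that closure_subset[of "{x. \<phi> x \<noteq> 0}"] by auto
    show "partial_deriv k (\<lambda>x. ?P n x $ i $ m) x = partial_deriv m (\<lambda>x. ?P n x $ i $ k) x" for i k m
      by (rule mollified_gradient_curl_free[OF \<rho>t \<rho>0 near(2)[OF x] sq(3) Fu Fu'(3)])
    show "partial_deriv k (\<lambda>x. ?Q n x $ i $ m) x = partial_deriv m (\<lambda>x. ?Q n x $ i $ k) x" for i k m
      by (rule mollified_gradient_curl_free[OF \<rho>t \<rho>0 near(2)[OF x] sq(4) Fv Fv'(3)])
    show "(\<Sum>k\<in>UNIV. partial_deriv k (\<lambda>x. isotropic \<mu> l (?P n x) $ i $ k) x) = 0" for i
      by (rule mollified_stress_divergence_free[OF \<rho>t \<rho>0 near(1)[OF x] S(2) C u(2) Fu Fu'(3)])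
    show "(\<Sum>k\<in>UNIV. partial_deriv k (\<lambda>x. isotropic \<mu> l (?Q n x) $ i $ k) x) = 0" for i
      by (rule mollified_stress_divergence_free[OF \<rho>t \<rho>0 near(1)[OF x] S(2) C v(2) Fv Fv'(3)])
  qed
  have Uj: "has_weak_jacobian UNIV U DU" using U by (simp add: W1inf_with_jacobian_def)
  \<comment> \<open>The smoothed tensor is divergence free where \<open>\<phi>\<close> is nonzero,
    the conservation law that Noether's theorem attaches to translations, and so may be tested with
    \<open>\<phi> U\<close>.\<close>
  note noether = divergence_free_against_weak_gradient[OF smooth_fun_eshelby[OF smooth] Uj \<phi>' div]
  have W: "?W \<in> borel_measurable lebesgue" "\<exists>M. AE x in lebesgue. norm (?W x) \<le> M"
    by (rule weighted_field_measurable_bounded[OF U test_function_partial[OF \<phi>'] \<phi>'])+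
  then obtain M where M: "AE x in lebesgue. norm (?W x) \<le> M" by blast
  have W0: "?W x = 0" if "x \<notin> ?K" for x
    using that partial_deriv_zero_outside_support[OF that] closure_subset[of "{x. \<phi> x \<noteq> 0}"]
    by (auto simp: vec_eq_iff)
  obtain k where k: "0 \<le> k" "\<And>a b. norm (eshelby \<mu> l a b) \<le> norm a * norm b * k"
    using bounded_bilinear.nonneg_bounded[OF bounded_bilinear_eshelby[of \<mu> l]] by blast
  have ls: "?K \<in> sets lebesgue" by (rule fmeasurableD[OF lmeasurable_compact[OF K(1)]])
  have fin: "(\<integral>\<^sup>+x. ennreal ((norm (F x))\<^sup>2) * indicator ?K x \<partial>lebesgue) < \<infinity>"
    if "integrable lebesgue (\<lambda>x. (norm (F x))\<^sup>2)" for F :: "real^3 \<Rightarrow> real^3^3"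
  proof -
    have "(\<integral>\<^sup>+x. ennreal ((norm (F x))\<^sup>2) * indicator ?K x \<partial>lebesgue) \<le> (\<integral>\<^sup>+x. ennreal ((norm (F x))\<^sup>2) \<partial>lebesgue)"
      by (intro nn_integral_mono) (simp add: indicator_def)
    also have "\<dots> < \<infinity>" using that by (simp add: nn_integral_eq_integral)
    finally show ?thesis .
  qed
  show ?thesis
  proof (rule bilinear_integral_limit[where K = ?K and P = ?P and Q = ?Q and p = Fu and q = Fv
        and B = "\<lambda>x P Q. eshelby \<mu> l P Q \<bullet> ?W x" and M = "k * \<bar>M\<bar>"])
    show "?P n \<in> borel_measurable lebesgue" "?Q n \<in> borel_measurable lebesgue" for n
      by (rule borel_measurable_convolution[OF \<rho>t Fu'(3)] borel_measurable_convolution[OF \<rho>t Fv'(3)])+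
    show "Fu \<in> borel_measurable lebesgue" "Fv \<in> borel_measurable lebesgue" "?K \<in> sets lebesgue"
      by (rule Fu' Fv' ls)+
    show "(\<lambda>n. \<integral>\<^sup>+x. ennreal ((norm (?P n x - Fu x))\<^sup>2) * indicator ?K x \<partial>lebesgue) \<longlonglongrightarrow> 0"
      by (rule mollification_L2_tendsto[OF \<rho> r0 Fu'(3) K(1) order_trans[OF K(2) S(2)] \<Omega>(1)])
         (unfold Fu, rule approx_u)
    show "(\<lambda>n. \<integral>\<^sup>+x. ennreal ((norm (?Q n x - Fv x))\<^sup>2) * indicator ?K x \<partial>lebesgue) \<longlonglongrightarrow> 0"
      by (rule mollification_L2_tendsto[OF \<rho> r0 Fv'(3) K(1) order_trans[OF K(2) S(2)] \<Omega>(1)])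
         (unfold Fv, rule approx_v)
    show "(\<integral>\<^sup>+x. ennreal ((norm (Fu x))\<^sup>2) * indicator ?K x \<partial>lebesgue) < \<infinity>"
      "(\<integral>\<^sup>+x. ennreal ((norm (Fv x))\<^sup>2) * indicator ?K x \<partial>lebesgue) < \<infinity>"
      by (rule fin[OF Fu'(2)] fin[OF Fv'(2)])+
    show "bilinear (\<lambda>P Q. eshelby \<mu> l P Q \<bullet> ?W x)" for x
      using bounded_bilinear_eshelby[of \<mu> l]
      by (auto simp: bilinear_def bounded_bilinear.add_left bounded_bilinear.add_right
          bounded_bilinear.scaleR_left bounded_bilinear.scaleR_right inner_add_left intro!: linearI)
    show "k * \<bar>M\<bar> \<ge> 0" using k by simp
    show "AE x in lebesgue. \<forall>a b. \<bar>eshelby \<mu> l a b \<bullet> ?W x\<bar> \<le> k * \<bar>M\<bar> * (norm a * norm b) * indicator ?K x"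
      using M
    proof (eventually_elim, intro allI)
      fix x :: "real^3" and a b :: "real^3^3"
      assume M: "norm (?W x) \<le> M"
      show "\<bar>eshelby \<mu> l a b \<bullet> ?W x\<bar> \<le> k * \<bar>M\<bar> * (norm a * norm b) * indicator ?K x"
      proof (cases "x \<in> ?K")
        case True
        have "\<bar>eshelby \<mu> l a b \<bullet> ?W x\<bar> \<le> norm (eshelby \<mu> l a b) * norm (?W x)"
          by (rule Cauchy_Schwarz_ineq2)
        also have "\<dots> \<le> (norm a * norm b * k) * \<bar>M\<bar>"
          using M k by (intro mult_mono) auto
        finally show ?thesis using True by (simp add: mult_ac)
      next
        case False
        show ?thesis unfolding W0[OF False] using False by simp
      qed
    qed
    show "integrable lebesgue (\<lambda>x. eshelby \<mu> l (?P n x) (?Q n x) \<bullet> ?W x)" for n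
      by (rule noether(1))
    show "integrable lebesgue (\<lambda>x. eshelby \<mu> l (Fu x) (Fv x) \<bullet> ?W x)"
      by (rule integrable_eshelby_pairing[OF bounded_bilinear_inner Fu'(1,2) Fv'(1,2) W(1) M])
    show "eventually (\<lambda>n. (LINT x|lebesgue. eshelby \<mu> l (?P n x) (?Q n x) \<bullet> ?W x) = 0) sequentially"
      by (intro always_eventually allI noether(2))
  qed
qed

section \<open>From the tensor to the vector field b\<close>

lemma locally_integrable_on_cmult:
  fixes f :: "real^'n \<Rightarrow> real"
  assumes "locally_integrable_on f S" shows "locally_integrable_on (\<lambda>x. f x * c) S"
  using assms by (auto simp: locally_integrable_on_def intro: set_integrable_mult_left)

lemma W1inf_with_jacobian_scaleR:
  fixes U :: "real^'n \<Rightarrow> real^'m"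
  assumes "W1inf_with_jacobian U DU"
  shows "W1inf_with_jacobian (\<lambda>x. c *\<^sub>R U x) (\<lambda>x. c *\<^sub>R DU x)"
  unfolding W1inf_with_jacobian_def
proof (intro conjI)
  show "continuous_on UNIV (\<lambda>x. c *\<^sub>R U x)"
    using assms by (auto simp: W1inf_with_jacobian_def intro!: continuous_intros)
  show "has_weak_jacobian UNIV (\<lambda>x. c *\<^sub>R U x) (\<lambda>x. c *\<^sub>R DU x)"
    unfolding has_weak_jacobian_def has_weak_partial_def
  proof (intro allI conjI impI)
    fix i j
    have w: "has_weak_partial UNIV j (\<lambda>x. U x $ i) (\<lambda>x. DU x $ i $ j)"
      using assms by (simp add: W1inf_with_jacobian_def has_weak_jacobian_def)
    then have "locally_integrable_on (\<lambda>x. U x $ i) UNIV" "locally_integrable_on (\<lambda>x. DU x $ i $ j) UNIV"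
      by (simp_all add: has_weak_partial_def)
    from this[THEN locally_integrable_on_cmult, of c]
    show "locally_integrable_on (\<lambda>x. (c *\<^sub>R U x) $ i) UNIV"
      "locally_integrable_on (\<lambda>x. (c *\<^sub>R DU x) $ i $ j) UNIV"
      by (simp_all add: mult.commute)
    fix \<phi> :: "real^'n \<Rightarrow> real" assume "test_function UNIV \<phi>"
    with w show "(LINT x:UNIV|lebesgue. (c *\<^sub>R U x) $ i * partial_deriv j \<phi> x)
        = - (LINT x:UNIV|lebesgue. (c *\<^sub>R DU x) $ i $ j * \<phi> x)"
      by (simp add: has_weak_partial_def set_lebesgue_integral_def mult.assoc)
  qed
  obtain M where M: "AE x in lebesgue. norm (U x) \<le> M \<and> norm (DU x) \<le> M"
    using assms by (auto simp: W1inf_with_jacobian_def)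
  have "AE x in lebesgue. norm (c *\<^sub>R U x) \<le> \<bar>c\<bar> * M \<and> norm (c *\<^sub>R DU x) \<le> \<bar>c\<bar> * M"
    using M by eventually_elim (simp add: mult_left_mono)
  then show "\<exists>M. AE x in lebesgue. norm (c *\<^sub>R U x) \<le> M \<and> norm (c *\<^sub>R DU x) \<le> M"
    by blast
qed

lemma transpose_isotropic: "transpose (isotropic \<mu> l A) = isotropic \<mu> l A"
  by (simp add: transpose_def vec_eq_iff isotropic_component add.commute)

lemma stress_form_isotropic:
  "stress_form (isotropic \<mu> l P) (isotropic \<mu> l Q) P Q Z = eshelby \<mu> l P Q \<bullet> transpose Z"
  unfolding stress_form_eq_sum eshelby_def[symmetric] by (simp add: inner_vec_def transpose_def)

text \<open>Both sides have the same inner product with every vector, by the dyad formula.\<close>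

lemma eshelby_vector:
  "(isotropic \<mu> l P \<bullet> Q) *\<^sub>R u - isotropic \<mu> l P *v (Q *v u) - isotropic \<mu> l Q *v (P *v u)
     = eshelby \<mu> l P Q *v u" (is "?b = _")
proof -
  have "?b \<bullet> \<xi> = (eshelby \<mu> l P Q *v u) \<bullet> \<xi>" for \<xi>
  proof -
    have "?b \<bullet> \<xi> = eshelby \<mu> l P Q \<bullet> transpose (\<chi> i j. u $ i * \<xi> $ j)"
      unfolding stress_form_dyad[OF transpose_isotropic transpose_isotropic] stress_form_isotropic ..
    also have "\<dots> = (eshelby \<mu> l P Q *v u) \<bullet> \<xi>"
      by (simp add: inner_vec_def transpose_def matrix_vector_mult_def sum_distrib_right mult.assoc)
    finally show ?thesis .
  qed
  then show ?thesis by (metis vector_eq_rdot)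
qed

lemma bounded_bilinear_matrix_vector_mult:
  "bounded_bilinear ((*v) :: real^'n^'m \<Rightarrow> real^'n \<Rightarrow> real^'m)"
  unfolding bilinear_conv_bounded_bilinear[symmetric] bilinear_def
  by (auto intro!: linearI simp: vec_eq_iff matrix_vector_mult_def algebra_simps sum.distrib sum_distrib_left)

text \<open>The integral of the tensor against the transposed Jacobian of \<open>\<phi> U\<close>
  has two halves: the one with derivatives of \<open>\<phi>\<close> is \<open>b\<close> tested with
  the gradient of \<open>\<phi>\<close>, the other is \<open>d\<close> tested with
  \<open>\<phi>\<close>. That they sum to zero is the weak divergence.\<close>

lemma eshelby_field_weak_divergence:
  fixes Gu Gv :: "real^3 \<Rightarrow> real^3^3"
  assumes \<Omega>: "open \<Omega>" "bounded \<Omega>" and S: "open S" "S \<subseteq> \<Omega>"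
    and C: "\<And>y A. y \<in> S \<Longrightarrow> C y A = isotropic \<mu> l A"
    and u: "weak_solution \<Omega> C u Gu f" and v: "weak_solution \<Omega> C v Gv g"
    and U: "W1inf_with_jacobian U DU"
    and b: "\<And>x. x \<in> S \<Longrightarrow> b x = eshelby \<mu> l (Gu x) (Gv x) *v U x"
    and d: "\<And>x. x \<in> S \<Longrightarrow> d x = eshelby \<mu> l (Gu x) (Gv x) \<bullet> transpose (DU x)"
  shows "has_weak_div S b d"
proof -
  define Fu where "Fu = (\<lambda>y. if y \<in> \<Omega> then Gu y else 0)"
  define Fv where "Fv = (\<lambda>y. if y \<in> \<Omega> then Gv y else 0)"
  let ?E = "\<lambda>x. eshelby \<mu> l (Fu x) (Fv x)"
  have H: "H1_with_gradient \<Omega> u Gu" "has_weak_div_matrix \<Omega> (\<lambda>y. C y (Gu y)) (\<lambda>y. 0)" "has_trace \<Omega> u Gu f"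
    "H1_with_gradient \<Omega> v Gv" "has_weak_div_matrix \<Omega> (\<lambda>y. C y (Gv y)) (\<lambda>y. 0)" "has_trace \<Omega> v Gv g"
    using u v by (simp_all add: weak_solution_def)
  then have sq: "square_integrable (lebesgue_on \<Omega>) Gu" "square_integrable (lebesgue_on \<Omega>) Gv"
    by (simp_all add: H1_with_gradient_def)
  note Fu = zero_extension_L2[OF \<Omega> sq(1) Fu_def] and Fv = zero_extension_L2[OF \<Omega> sq(2) Fv_def]
  have FS: "Fu x = Gu x" "Fv x = Gv x" if "x \<in> S" for x
    using that S(2) by (auto simp: Fu_def Fv_def)
  obtain M where M: "AE x in lebesgue. norm (U x) \<le> M \<and> norm (DU x) \<le> M"
    using U by (auto simp: W1inf_with_jacobian_def)
  show ?thesis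
    unfolding has_weak_div_def
  proof (intro conjI allI impI)
    show "locally_integrable_on b S"
      unfolding locally_integrable_on_def
    proof (intro allI impI)
      fix K assume K: "compact K \<and> K \<subseteq> S"
      have [measurable]: "K \<in> sets lebesgue" using fmeasurableD[OF lmeasurable_compact] K by blast
      have "continuous_on UNIV U" using U by (simp add: W1inf_with_jacobian_def)
      then have [measurable]: "U \<in> borel_measurable lebesgue"
        by (intro measurable_completion) (simp add: borel_measurable_continuous_onI)
      \<comment> \<open>The indicator is attached to the bounded factor, so the integrability of the
        pairing applies on the whole space.\<close>
      have "integrable lebesgue (\<lambda>x. ?E x *v (indicator K x *\<^sub>R U x))"
      proof (rule integrable_eshelby_pairing[OF bounded_bilinear_matrix_vector_mult Fu(1,2) Fv(1,2)])
        show "(\<lambda>x. indicator K x *\<^sub>R U x) \<in> borel_measurable lebesgue" by measurable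
        show "AE x in lebesgue. norm (indicator K x *\<^sub>R U x :: real^3) \<le> \<bar>M\<bar>"
          using M by eventually_elim (auto simp: indicator_def)
      qed
      moreover have "(\<lambda>x. ?E x *v (indicator K x *\<^sub>R U x)) = (\<lambda>x. indicator K x *\<^sub>R b x)"
        using K by (auto simp: fun_eq_iff indicator_def b FS subset_iff)
      ultimately show "b absolutely_integrable_on K" by (simp add: set_integrable_def)
    qed
    show "locally_integrable_on d S"
      unfolding locally_integrable_on_def
    proof (intro allI impI)
      fix K assume K: "compact K \<and> K \<subseteq> S"
      have "integrable lebesgue (\<lambda>x. ?E x \<bullet> (indicator K x *\<^sub>R transpose (DU x)))"
      proof (rule integrable_eshelby_pairing[OF bounded_bilinear_inner Fu(1,2) Fv(1,2)])
        show "(\<lambda>x. indicator K x *\<^sub>R transpose (DU x)) \<in> borel_measurable lebesgue"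
        proof (rule borel_measurable_matrix)
          fix i j
          have "locally_integrable_on (\<lambda>x. DU x $ j $ i) UNIV"
            using U by (simp add: W1inf_with_jacobian_def has_weak_jacobian_def has_weak_partial_def)
          then have "integrable lebesgue (\<lambda>x. indicator K x *\<^sub>R (DU x $ j $ i))"
            using K by (simp add: locally_integrable_on_def set_integrable_def)
          then show "(\<lambda>x. (indicator K x *\<^sub>R transpose (DU x)) $ i $ j) \<in> borel_measurable lebesgue"
            by (simp add: transpose_def)
        qed
        show "AE x in lebesgue. norm (indicator K x *\<^sub>R transpose (DU x)) \<le> (\<Sum>i\<in>(UNIV::3 set). \<Sum>j\<in>(UNIV::3 set). \<bar>M\<bar>)"
          using M
        proof eventually_elim
          case (elim x)
          have "\<bar>DU x $ j $ i\<bar> \<le> \<bar>M\<bar>" for i j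
            using component_le_norm_cart[of "DU x $ j" i] Finite_Cartesian_Product.norm_nth_le[of "DU x" j] elim by linarith
          then show ?case
            by (intro order_trans[OF norm_matrix_le_sum] sum_mono) (simp add: transpose_def indicator_def)
        qed
      qed
      moreover have "(\<lambda>x. ?E x \<bullet> (indicator K x *\<^sub>R transpose (DU x))) = (\<lambda>x. indicator K x *\<^sub>R d x)"
        using K by (auto simp: fun_eq_iff indicator_def d FS subset_iff)
      ultimately show "d absolutely_integrable_on K" by (simp add: set_integrable_def)
    qed
    fix \<phi> assume \<phi>: "test_function S \<phi>"
    have \<phi>': "test_function UNIV \<phi>" using test_function_mono[OF \<phi>] by simp
    have zero: "test_function UNIV (\<lambda>x::real^3. 0)"
      using test_function_mult[OF smooth_fun_const \<phi>', of 0] by simp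
    \<comment> \<open>The zero weights are written out so that both halves are literal instances of
      \<open>weighted_field_measurable_bounded\<close>.\<close>
    let ?W1 = "\<lambda>x. \<chi> k m. partial_deriv k \<phi> x * U x $ m + 0 * DU x $ m $ k"
    let ?W2 = "\<lambda>x. \<chi> k m. 0 * U x $ m + \<phi> x * DU x $ m $ k"
    obtain M1 where W1: "?W1 \<in> borel_measurable lebesgue" "AE x in lebesgue. norm (?W1 x) \<le> M1"
      using weighted_field_measurable_bounded[where \<alpha> = "\<lambda>k. partial_deriv k \<phi>" and \<beta> = "\<lambda>_. 0",
          OF U test_function_partial[OF \<phi>'] zero] by blast
    obtain M2 where W2: "?W2 \<in> borel_measurable lebesgue" "AE x in lebesgue. norm (?W2 x) \<le> M2"
      using weighted_field_measurable_bounded[where \<alpha> = "\<lambda>_ _. 0" and \<beta> = \<phi>, OF U zero \<phi>'] by blast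
    have i1: "integrable lebesgue (\<lambda>x. ?E x \<bullet> ?W1 x)"
      by (rule integrable_eshelby_pairing[OF bounded_bilinear_inner Fu(1,2) Fv(1,2) W1])
    have i2: "integrable lebesgue (\<lambda>x. ?E x \<bullet> ?W2 x)"
      by (rule integrable_eshelby_pairing[OF bounded_bilinear_inner Fu(1,2) Fv(1,2) W2])
    have out: "\<phi> x = 0" "partial_deriv k \<phi> x = 0" if "x \<notin> S" for x k
    proof -
      have "x \<notin> closure {x. \<phi> x \<noteq> 0}" using \<phi> that by (auto simp: test_function_def)
      then show "\<phi> x = 0" "partial_deriv k \<phi> x = 0"
        using closure_subset[of "{x. \<phi> x \<noteq> 0}"] partial_deriv_zero_outside_support by auto
    qed
    have e1: "(LINT x:S|lebesgue. b x \<bullet> (\<chi> j. partial_deriv j \<phi> x)) = (LINT x|lebesgue. ?E x \<bullet> ?W1 x)"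
      unfolding set_lebesgue_integral_def
    proof (intro Bochner_Integration.integral_cong refl)
      fix x
      show "indicator S x *\<^sub>R (b x \<bullet> (\<chi> j. partial_deriv j \<phi> x)) = ?E x \<bullet> ?W1 x"
      proof (cases "x \<in> S")
        case True
        then show ?thesis
          by (simp add: b FS inner_vec_def matrix_vector_mult_def sum_distrib_left mult_ac)
      qed (simp add: out inner_vec_def)
    qed
    have e2: "(LINT x:S|lebesgue. d x * \<phi> x) = (LINT x|lebesgue. ?E x \<bullet> ?W2 x)"
      unfolding set_lebesgue_integral_def
    proof (intro Bochner_Integration.integral_cong refl)
      fix x
      show "indicator S x *\<^sub>R (d x * \<phi> x) = ?E x \<bullet> ?W2 x"
      proof (cases "x \<in> S")
        case True
        then show ?thesis
          by (simp add: d FS inner_vec_def transpose_def sum_distrib_left mult_ac)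
      qed (simp add: out inner_vec_def)
    qed
    have "(LINT x|lebesgue. ?E x \<bullet> ?W1 x) + (LINT x|lebesgue. ?E x \<bullet> ?W2 x)
       = (LINT x|lebesgue. ?E x \<bullet> (\<chi> k m. partial_deriv k \<phi> x * U x $ m + \<phi> x * DU x $ m $ k))"
      unfolding Bochner_Integration.integral_add[OF i1 i2, symmetric] inner_add_right[symmetric]
      by (intro Bochner_Integration.integral_cong arg_cong2[where f = inner] refl) (simp add: vec_eq_iff)
    also have "\<dots> = 0"
      by (rule eshelby_weakly_divergence_free[OF \<Omega> S C H(1,2) H(4,5)
            has_trace_gradient_approximable[OF \<Omega>(1) H(3)] has_trace_gradient_approximable[OF \<Omega>(1) H(6)]
            U \<phi> Fu_def Fv_def])
    finally show "(LINT x:S|lebesgue. b x \<bullet> (\<chi> j. partial_deriv j \<phi> x)) = - (LINT x:S|lebesgue. d x * \<phi> x)"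
      unfolding e1 e2 by simp
  qed
qed

theorem lemma6p14:
  fixes r0 \<mu>i li \<mu>e le :: real
    and \<Omega> \<Gamma> D0 D1 :: "(real^3) set"
    and V0 V1 W :: "(real^3)^'N::finite"
    and U Ut u0 v0 f g b :: "real^3 \<Rightarrow> real^3"
    and DU DUt Du0 Dv0 :: "real^3 \<Rightarrow> real^3^3"
    and C :: "real^3 \<Rightarrow> real^3^3 \<Rightarrow> real^3^3"
  assumes "r0 > 0"
    and "open \<Omega>" and "connected \<Omega>" and "\<Omega> \<noteq> {}" and "bounded \<Omega>" and "lipschitz_boundary \<Omega>"
    and "openin (top_of_set (frontier \<Omega>)) \<Gamma>"
    and "closed_polyhedron D0" and "D0 \<subseteq> \<Omega>" and "setdist D0 (frontier \<Omega>) \<ge> r0"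
    and "lipschitz_boundary (\<Omega> - D0)"
    and "closed_polyhedron D1" and "D1 \<subseteq> \<Omega>" and "setdist D1 (frontier \<Omega>) \<ge> r0"
    and "lipschitz_boundary (\<Omega> - D1)"
    and "bij_betw (\<lambda>i. V0 $ i) UNIV (vertices D0)"
    and "bij_betw (\<lambda>i. V1 $ i) UNIV (vertices D1)"
    and "W1inf_with_jacobian U DU"
    and "\<forall>i. U (V0 $ i) = V1 $ i - V0 $ i"
    and "closure {x. U x \<noteq> 0} \<subseteq> {x. infdist x D0 \<le> r0 / 4}"
    and "W = (\<chi> i. V1 $ i - V0 $ i)" and "W \<noteq> 0"
    and "Ut = (\<lambda>x. U x /\<^sub>R norm W)" and "DUt = (\<lambda>x. DU x /\<^sub>R norm W)"
    and "lame_admissible \<mu>i li" and "lame_admissible \<mu>e le"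
    and "C = elasticity \<Omega> D0 \<mu>i li \<mu>e le"
    and "f \<in> H_half_co \<Omega> \<Gamma>" and "g \<in> H_half_co \<Omega> \<Gamma>"
    and "weak_solution \<Omega> C u0 Du0 f" and "weak_solution \<Omega> C v0 Dv0 g"
    and "b = (\<lambda>x. (C x (Du0 x) \<bullet> Dv0 x) *\<^sub>R Ut x
                   - C x (Du0 x) *v (Dv0 x *v Ut x)
                   - C x (Dv0 x) *v (Du0 x *v Ut x))"
  shows "\<forall>S \<in> {\<Omega> - D0, interior D0}. \<exists>div_b. has_weak_div S b div_b \<and>
           (AE x\<in>S in lebesgue.
              trace (DUt x) * (C x (Du0 x) \<bullet> Dv0 x)
              - C x (Du0 x) \<bullet> (Dv0 x ** DUt x)
              - C x (Dv0 x) \<bullet> (Du0 x ** DUt x) = div_b x)"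
proof
  fix S assume S: "S \<in> {\<Omega> - D0, interior D0}"
  \<comment> \<open>Compactness, inherited from the closed ball, makes \<open>D0\<close> closed and
    hence its complement in \<open>\<Omega>\<close> open.\<close>
  have "compact D0"
    using \<open>closed_polyhedron D0\<close> homeomorphic_compactness[of D0 "cball 0 1 :: (real^3) set"]
    by (simp add: closed_polyhedron_def)
  then have S_open: "open S" "S \<subseteq> \<Omega>"
    using S \<open>open \<Omega>\<close> \<open>D0 \<subseteq> \<Omega>\<close> interior_subset[of D0] by (auto intro: compact_imp_closed)
  \<comment> \<open>On either set one indicator is 1 and the other 0. From here on the two cases
    differ only in the pair of constants.\<close>
  obtain \<mu> l where iso: "C x A = isotropic \<mu> l A" if "x \<in> S" for x A
  proof (cases "S = interior D0")
    case True
    have "x \<in> D0" if "x \<in> S" for x using that True interior_subset by auto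
    then show ?thesis using \<open>D0 \<subseteq> \<Omega>\<close> \<open>C = _\<close> by (intro that[of \<mu>i li]) (simp add: elasticity_def)
  next
    case False
    then have "S = \<Omega> - D0" using S by simp
    then show ?thesis using \<open>C = _\<close> by (intro that[of \<mu>e le]) (simp add: elasticity_def)
  qed
  have Ut: "W1inf_with_jacobian Ut DUt"
    using W1inf_with_jacobian_scaleR[OF \<open>W1inf_with_jacobian U DU\<close>, of "inverse (norm W)"]
    by (simp add: \<open>Ut = _\<close> \<open>DUt = _\<close>)
  \<comment> \<open>The left-hand side is taken as representative of the divergence, so the equality
    almost everywhere is trivial and the content lies in the weak divergence.\<close>
  let ?d = "\<lambda>x. trace (DUt x) * (C x (Du0 x) \<bullet> Dv0 x)
    - C x (Du0 x) \<bullet> (Dv0 x ** DUt x) - C x (Dv0 x) \<bullet> (Du0 x ** DUt x)"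
  have "has_weak_div S b ?d"
  proof (rule eshelby_field_weak_divergence[OF \<open>open \<Omega>\<close> \<open>bounded \<Omega>\<close> S_open iso
        \<open>weak_solution \<Omega> C u0 Du0 f\<close> \<open>weak_solution \<Omega> C v0 Dv0 g\<close> Ut])
    fix x assume "x \<in> S"
    then show "b x = eshelby \<mu> l (Du0 x) (Dv0 x) *v Ut x"
      by (simp add: \<open>b = _\<close> iso eshelby_vector)
    show "?d x = eshelby \<mu> l (Du0 x) (Dv0 x) \<bullet> transpose (DUt x)"
      using \<open>x \<in> S\<close> by (simp add: iso stress_form_isotropic[symmetric] stress_form_def)
  qed
  then show "\<exists>div_b. has_weak_div S b div_b \<and> (AE x\<in>S in lebesgue. ?d x = div_b x)"
    by (intro exI[of _ ?d]) simp
qed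

end
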